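(* Let $\Lambda$ be a finite lattice of fermionic modes with metric $d$, and let $\Phi$ be a time-independent interaction on $\Lambda$ assigning to each finite $X\subset\Lambda$ a self-adjoint operator $\Phi(X)$ supported on $X$ and even under fermion parity. Let $F:[0,\infty)\to(0,\infty)$ be an $F$-function with convolution constant $C_F$, let $G(x,y)=C_F^{-1}F(d(x,y))$, and suppose that for a constant $g>0$ $$\sum_{Z\subset\Lambda:\ x,y\in Z}\|\Phi(Z)\|\le g\,G(x,y)\qquad\text{for all }x,y\in\Lambda .$$ Let $H=\sum_{X\subset\Lambda}\Phi(X)$, let $O$ be an observable supported on a finite set $X_0\subset\Lambda$ with $|X_0|=O(1)$, let $T>0$ and $R>0$, and let $H_R=\sum_{X\subset X_R}\Phi(X)$ be the truncation of $H$ to $X_R=\{x\in\Lambda:d(x,X_0)\le R\}$. Write $O(t)=e^{itH}Oe^{-itH}$ and $O_R(t)=e^{itH_R}Oe^{-itH_R}$ and, for a normalized initial state $|\psi_0\rangle$, let $J_H(O)=\int_0^T\langle\psi_0|O(t)|\psi_0\rangle\,dt$ and $J_{H_R}(O)=\int_0^T\langle\psi_0|O_R(t)|\psi_0\rangle\,dt$. Then $$\big|J_H(O)-J_{H_R}(O)\big|\le\int_0^T\|O(t)-O_R(t)\|\,dt\le 2\|O\|\,\Sigma_R(X_0)\int_0^T\big(e^{2gt}-1\big)\,dt,$$ where $$\Sigma_R(X_0)=\sum_{x\in\partial_\Phi X_0}\ \sum_{y\notin X_R}G(x,y)$$ is a finite tail sum (with $|\partial_\Phi X_0|\le|X_0|=O(1)$)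 that decays monotonically to $0$ as $R\to\infty$.
   Context: An $F$-function is a non-increasing $F:[0,\infty)\to(0,\infty)$ that is uniformly integrable, $\sup_x\sum_{y}F(d(x,y))<\infty$, and satisfies the convolution condition $C_F:=\sup_{x,y}\sum_z\frac{F(d(x,z))F(d(z,y))}{F(d(x,y))}<\infty$. The $\Phi$-boundary of $X$ is $\partial_\Phi X=\{x\in X:\ \exists Z\ni x,\ Z\cap(\Lambda\setminus X)\neq\emptyset,\ \Phi(Z)\ne0\}$, the set of sites of $X$ coupled by $\Phi$ to sites outside $X$. "Supported on $X$" means belonging to the algebra generated by the fermionic creation and annihilation operators of the sites in $X$. $\|\cdot\|$ is the operator norm. $J_H(O)$ and $J_{H_R}(O)$ are the time-accumulated expectations ("dense outputs") of $O$ under the full and the truncated dynamics. *)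

theory Defs
  imports "HOL-Analysis.Analysis"
begin

text \<open>
  The lattice is a finite type \<open>'a\<close>, one fermionic mode per site.  The Fock space has the occupation
  number basis \<open>|S\<rangle>\<close>, with \<open>S\<close> the set of occupied sites, so states are vectors and operators are
  matrices indexed by \<open>'a set\<close>; \<open>A $ S' $ S\<close> is the matrix element \<open>\<langle>S'|A|S\<rangle>\<close>.
\<close>

type_synonym 'a fock = "complex ^ ('a set)"
type_synonym 'a fock_op = "complex ^ ('a set) ^ ('a set)"

section \<open>Operators\<close>

definition dagger :: "complex ^ 'n ^ 'm \<Rightarrow> complex ^ 'm ^ 'n" where
  "dagger A = (\<chi> i j. cnj (A $ j $ i))"

definition self_adjoint :: "complex ^ 'n ^ 'n \<Rightarrow> bool" where
  "self_adjoint A \<longleftrightarrow> dagger A = A"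

definition cscale :: "complex \<Rightarrow> complex ^ 'n ^ 'm \<Rightarrow> complex ^ 'n ^ 'm" where
  "cscale c A = (\<chi> i j. c * A $ i $ j)"

text \<open>The norm that the library puts on the matrix type is the Frobenius norm; the operator norm
  with respect to the Hilbert space norm is the following.\<close>

definition op_norm :: "complex ^ 'n ^ 'm \<Rightarrow> real" where
  "op_norm A = onorm (\<lambda>v. A *v v)"

definition mexp :: "complex ^ 'n ^ 'n \<Rightarrow> complex ^ 'n ^ 'n" where
  "mexp A = (\<Sum>n. (1 / fact n) *\<^sub>R (((**) A ^^ n) (mat 1)))"

definition heisenberg :: "complex ^ 'n ^ 'n \<Rightarrow> complex ^ 'n ^ 'n \<Rightarrow> real \<Rightarrow> complex ^ 'n ^ 'n" where
  "heisenberg H A t =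
     mexp (cscale (\<i> * of_real t) H) ** A ** mexp (cscale (- \<i> * of_real t) H)"

definition expect :: "complex ^ 'n \<Rightarrow> complex ^ 'n ^ 'n \<Rightarrow> complex" where
  "expect \<psi> A = (\<Sum>i\<in>UNIV. cnj (\<psi> $ i) * (A *v \<psi>) $ i)"

definition dense_output ::
  "complex ^ 'n ^ 'n \<Rightarrow> complex ^ 'n ^ 'n \<Rightarrow> complex ^ 'n \<Rightarrow> real \<Rightarrow> complex" where
  "dense_output H A \<psi> T = integral {0..T} (\<lambda>t. expect \<psi> (heisenberg H A t))"

section \<open>Fermions\<close>

text \<open>The linear order on the sites serves only to fix the Jordan-Wigner signs:
  \<open>a\<^sub>x |S\<rangle> = (-1)^|{y \<in> S. y < x}| |S - {x}\<rangle>\<close> if \<open>x \<in> S\<close>, and \<open>a\<^sub>x |S\<rangle> = 0\<close> otherwise.\<close>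

definition annihilation :: "'a::{finite,linorder} \<Rightarrow> 'a fock_op" where
  "annihilation x = (\<chi> S' S. if x \<in> S \<and> S' = S - {x} then (-1) ^ card {y \<in> S. y < x} else 0)"

definition creation :: "'a::{finite,linorder} \<Rightarrow> 'a fock_op" where
  "creation x = dagger (annihilation x)"

inductive_set local_algebra :: "'a::{finite,linorder} set \<Rightarrow> 'a fock_op set"
  for X :: "'a set" where
  one: "mat 1 \<in> local_algebra X"
| annih: "x \<in> X \<Longrightarrow> annihilation x \<in> local_algebra X"
| creat: "x \<in> X \<Longrightarrow> creation x \<in> local_algebra X"
| scale: "A \<in> local_algebra X \<Longrightarrow> cscale c A \<in> local_algebra X"
| add: "A \<in> local_algebra X \<Longrightarrow> B \<in> local_algebra X \<Longrightarrow> A + B \<in> local_algebra X"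
| mult: "A \<in> local_algebra X \<Longrightarrow> B \<in> local_algebra X \<Longrightarrow> A ** B \<in> local_algebra X"

definition parity :: "'a::finite fock_op" where
  "parity = (\<chi> S' S. if S' = S then (-1) ^ card S else 0)"

text \<open>The parity operator is its own inverse, so this is invariance under conjugation by it.\<close>

definition even_op :: "'a::finite fock_op \<Rightarrow> bool" where
  "even_op A \<longleftrightarrow> parity ** A ** parity = A"

section \<open>Interactions\<close>

definition fermionic_interaction :: "('a::{finite,linorder} set \<Rightarrow> 'a fock_op) \<Rightarrow> bool" where
  "fermionic_interaction \<Phi> \<longleftrightarrow>
     (\<forall>X. self_adjoint (\<Phi> X) \<and> \<Phi> X \<in> local_algebra X \<and> even_op (\<Phi> X))"

definition hamiltonian :: "('a::finite set \<Rightarrow> 'a fock_op) \<Rightarrow> 'a fock_op" where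
  "hamiltonian \<Phi> = (\<Sum>X\<in>UNIV. \<Phi> X)"

definition hamiltonian_on :: "('a::finite set \<Rightarrow> 'a fock_op) \<Rightarrow> 'a set \<Rightarrow> 'a fock_op" where
  "hamiltonian_on \<Phi> Y = (\<Sum>X\<in>Pow Y. \<Phi> X)"

definition Phi_boundary :: "('a::finite set \<Rightarrow> 'a fock_op) \<Rightarrow> 'a set \<Rightarrow> 'a set" where
  "Phi_boundary \<Phi> X = {x \<in> X. \<exists>Z. x \<in> Z \<and> Z \<inter> (UNIV - X) \<noteq> {} \<and> \<Phi> Z \<noteq> 0}"

definition conv_ratio :: "('a::finite \<Rightarrow> 'a \<Rightarrow> real) \<Rightarrow> (real \<Rightarrow> real) \<Rightarrow> 'a \<Rightarrow> 'a \<Rightarrow> real" where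
  "conv_ratio d F x y = (\<Sum>z\<in>UNIV. F (d x z) * F (d z y) / F (d x y))"

definition F_function :: "('a::finite \<Rightarrow> 'a \<Rightarrow> real) \<Rightarrow> (real \<Rightarrow> real) \<Rightarrow> bool" where
  "F_function d F \<longleftrightarrow>
     antimono_on {0..} F \<and> (\<forall>r\<ge>0. F r > 0) \<and>
     bdd_above (range (\<lambda>x. \<Sum>y\<in>UNIV. F (d x y))) \<and>
     bdd_above (range (\<lambda>(x, y). conv_ratio d F x y))"

definition conv_const :: "('a::finite \<Rightarrow> 'a \<Rightarrow> real) \<Rightarrow> (real \<Rightarrow> real) \<Rightarrow> real" where
  "conv_const d F = (SUP (x, y)\<in>UNIV. conv_ratio d F x y)"

definition G_kernel :: "('a::finite \<Rightarrow> 'a \<Rightarrow> real) \<Rightarrow> (real \<Rightarrow> real) \<Rightarrow> 'a \<Rightarrow> 'a \<Rightarrow> real" where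
  "G_kernel d F x y = inverse (conv_const d F) * F (d x y)"

definition dist_set :: "('a \<Rightarrow> 'a \<Rightarrow> real) \<Rightarrow> 'a \<Rightarrow> 'a set \<Rightarrow> real" where
  "dist_set d x X = (INF y\<in>X. d x y)"

definition fattening :: "('a \<Rightarrow> 'a \<Rightarrow> real) \<Rightarrow> 'a set \<Rightarrow> real \<Rightarrow> 'a set" where
  "fattening d X R = {x. dist_set d x X \<le> R}"

definition tail_sum ::
  "('a::finite \<Rightarrow> 'a \<Rightarrow> real) \<Rightarrow> (real \<Rightarrow> real) \<Rightarrow> ('a set \<Rightarrow> 'a fock_op) \<Rightarrow> 'a set \<Rightarrow> real \<Rightarrow> real" where
  "tail_sum d F \<Phi> X R =
     (\<Sum>x\<in>Phi_boundary \<Phi> X. \<Sum>y\<in>UNIV - fattening d X R. G_kernel d F x y)"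

end

theory Submission
  imports Defs
begin

text \<open>
  Write \<open>\<tau>\<close> for the truncated dynamics and \<open>W = X\<^sub>R\<close>.  By Duhamel's formula
  \<open>\<parallel>O(t) - O\<^sub>R(t)\<parallel> \<le> \<integral>\<^sub>0\<^sup>t \<parallel>[H - H\<^sub>R, \<tau>\<^sub>s(O)]\<parallel> ds\<close>, where \<open>H - H\<^sub>R\<close> consists of the terms \<open>\<Phi>(Y)\<close> with
  \<open>Y\<close> not contained in \<open>W\<close>.  For \<open>v\<^sub>A(s) = \<Sum>\<^sub>Y \<parallel>[\<tau>\<^sub>s(A), \<Phi>(Y)]\<parallel>\<close>, summed over these \<open>Y\<close>, the Lieb-Robinson
  argument gives a system of integral inequalities for the functions \<open>v\<^bsub>\<Phi>(Z)\<^esub>\<close>, which the convolution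
  property of \<open>G\<close> closes with the supersolution
  \<open>2 \<parallel>\<Phi>(Z)\<parallel> g (\<Sum>\<^bsub>z \<in> Z\<^esub> D(z)) e\<^bsup>2gs\<^esup>\<close>, where \<open>D(z) = \<Sum>\<^bsub>y \<notin> W\<^esub> G(z, y)\<close>.  One further step from \<open>O\<close>,
  through the terms that straddle the boundary of \<open>X\<^sub>0\<close>, bounds \<open>v\<^sub>O(s)\<close> by \<open>2 \<parallel>O\<parallel> g \<Sigma>\<^sub>R e\<^bsup>2gs\<^esup>\<close>, and
  integration yields \<open>\<parallel>O\<parallel> \<Sigma>\<^sub>R (e\<^bsup>2gt\<^esup> - 1)\<close>.  The commutator estimates hold in any real Banach algebra
  as soon as the exponentials of the generators are contractions; locality enters only through the
  commutation of even operators with operators on disjoint sites.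
\<close>

section \<open>The operator norm algebra of matrices\<close>

lemma bounded_linear_matrix_vector_mult: "bounded_linear (\<lambda>v. A *v v)"
  for A :: "complex ^ 'n ^ 'm"
  by (rule matrix_vector_mul_bounded_linear)

lemma norm_matrix_vector_le_op_norm: "norm (A *v v) \<le> op_norm A * norm v"
  for A :: "complex ^ 'n ^ 'm"
  unfolding op_norm_def by (rule onorm[OF bounded_linear_matrix_vector_mult])

lemma norm_entry_le_op_norm: "norm (A $ i $ j) \<le> op_norm A"
  for A :: "complex ^ 'n ^ 'm"
proof -
  have "norm (A $ i $ j) = norm ((A *v axis j 1) $ i)"
    by (simp add: matrix_vector_mult_def axis_def if_distrib[of "(*) _"] cong: if_cong)
  also have "\<dots> \<le> norm (A *v axis j 1)" by (rule Finite_Cartesian_Product.norm_nth_le)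
  also have "\<dots> \<le> op_norm A" using norm_matrix_vector_le_op_norm[of A "axis j 1"] by simp
  finally show ?thesis .
qed

lemma op_norm_nonneg: "op_norm A \<ge> 0" for A :: "complex ^ 'n ^ 'm"
  unfolding op_norm_def by (rule onorm_pos_le[OF bounded_linear_matrix_vector_mult])

lemma op_norm_0: "op_norm 0 = 0"
  by (simp add: op_norm_def onorm_zero)

lemma op_norm_eq_0: "op_norm A = 0 \<longleftrightarrow> A = 0" for A :: "complex ^ 'n ^ 'm"
proof
  assume "op_norm A = 0"
  then have "A $ i $ j = 0" for i j using norm_entry_le_op_norm[of A i j] by simp
  then show "A = 0" by (simp add: vec_eq_iff)
qed (simp add: op_norm_0)

lemma op_norm_triangle: "op_norm (A + B) \<le> op_norm A + op_norm B" for A :: "complex ^ 'n ^ 'm"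
  unfolding op_norm_def matrix_vector_mult_add_rdistrib
  by (rule onorm_triangle; rule bounded_linear_matrix_vector_mult)

lemma scaleR_matrix_vector_mult: "(r *\<^sub>R A) *v v = r *\<^sub>R (A *v v)" for A :: "complex ^ 'n ^ 'm"
  by (simp add: vec_eq_iff matrix_vector_mult_def scaleR_sum_right)

lemma op_norm_scaleR: "op_norm (r *\<^sub>R A) = \<bar>r\<bar> * op_norm A" for A :: "complex ^ 'n ^ 'm"
  using onorm_scaleR[OF bounded_linear_matrix_vector_mult, of r A]
  by (simp add: op_norm_def scaleR_matrix_vector_mult)

lemma op_norm_mult: "op_norm (A ** B) \<le> op_norm A * op_norm B"
  for A :: "complex ^ 'n ^ 'm" and B :: "complex ^ 'k ^ 'n"
  using onorm_compose[OF bounded_linear_matrix_vector_mult bounded_linear_matrix_vector_mult, of A B]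
  by (simp add: op_norm_def matrix_vector_mul_assoc o_def)

lemma op_norm_mat_1: "op_norm (mat 1 :: complex ^ 'n ^ 'n) = 1"
proof -
  have "op_norm (mat 1 :: complex ^ 'n ^ 'n) \<le> 1"
    unfolding op_norm_def by (rule onorm_le) simp
  moreover have "1 \<le> op_norm (mat 1 :: complex ^ 'n ^ 'n)"
    using norm_entry_le_op_norm[of "mat 1 :: complex ^ 'n ^ 'n" undefined undefined]
    by (simp add: mat_def)
  ultimately show ?thesis by simp
qed

text \<open>Together with \<open>op_norm_le_norm\<close> this makes the Frobenius and the operator
  norm equivalent, so that limits can be carried between the matrix type and its copy
  \<open>opalg\<close> below. Only finiteness of the constants matters.\<close>

lemma norm_le_op_norm: "norm A \<le> real CARD('m) * real CARD('n) * op_norm A"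
  for A :: "complex ^ 'n ^ 'm"
proof -
  have row: "norm (A $ i) \<le> real CARD('n) * op_norm A" for i
  proof -
    have "norm (A $ i) \<le> (\<Sum>j\<in>UNIV. norm (A $ i $ j))"
      unfolding norm_vec_def by (rule L2_set_le_sum) simp
    also have "\<dots> \<le> real CARD('n) * op_norm A"
      using norm_entry_le_op_norm by (rule sum_bounded_above)
    finally show ?thesis .
  qed
  have "norm A \<le> (\<Sum>i\<in>UNIV. norm (A $ i))"
    unfolding norm_vec_def by (rule L2_set_le_sum) simp
  also have "\<dots> \<le> real CARD('m) * (real CARD('n) * op_norm A)"
    using row by (rule sum_bounded_above)
  finally show ?thesis by (simp add: mult.assoc)
qed

lemma op_norm_le_norm: "op_norm A \<le> real CARD('m) * real CARD('n) * norm A"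
  for A :: "complex ^ 'n ^ 'm"
proof -
  have entry: "norm (A $ i $ j) \<le> norm A" for i j
    using Finite_Cartesian_Product.norm_nth_le[of "A $ i" j] Finite_Cartesian_Product.norm_nth_le[of A i] by (rule order_trans)
  have "norm (A *v v) \<le> real CARD('m) * real CARD('n) * norm A * norm v" for v
  proof -
    have comp: "norm ((A *v v) $ i) \<le> real CARD('n) * (norm A * norm v)" for i
    proof -
      have "norm ((A *v v) $ i) \<le> (\<Sum>j\<in>UNIV. norm (A $ i $ j * v $ j))"
        unfolding matrix_vector_mult_def by (simp add: norm_sum)
      also have "\<dots> \<le> real CARD('n) * (norm A * norm v)"
        by (rule sum_bounded_above)
          (auto simp: norm_mult intro!: mult_mono entry Finite_Cartesian_Product.norm_nth_le)
      finally show ?thesis .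
    qed
    have "norm (A *v v) \<le> (\<Sum>i\<in>UNIV. norm ((A *v v) $ i))"
      unfolding norm_vec_def by (rule L2_set_le_sum) simp
    also have "\<dots> \<le> real CARD('m) * (real CARD('n) * (norm A * norm v))"
      using comp by (rule sum_bounded_above)
    finally show ?thesis by (simp add: mult.assoc)
  qed
  then show ?thesis unfolding op_norm_def by (rule onorm_le)
qed

text \<open>A copy of the matrix type normed by \<open>op_norm\<close>, so that the exponential of the library applies.\<close>

typedef ('n::finite) opalg = "UNIV :: (complex ^ 'n ^ 'n) set"
  morphisms mat_of op_of by simp

setup_lifting type_definition_opalg

instantiation opalg :: (finite) real_normed_algebra_1
begin

lift_definition zero_opalg :: "'a opalg" is 0 .
lift_definition one_opalg :: "'a opalg" is "mat 1" .
lift_definition plus_opalg :: "'a opalg \<Rightarrow> 'a opalg \<Rightarrow> 'a opalg" is "(+)" .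
lift_definition minus_opalg :: "'a opalg \<Rightarrow> 'a opalg \<Rightarrow> 'a opalg" is "(-)" .
lift_definition uminus_opalg :: "'a opalg \<Rightarrow> 'a opalg" is uminus .
lift_definition times_opalg :: "'a opalg \<Rightarrow> 'a opalg \<Rightarrow> 'a opalg" is "(**)" .
lift_definition scaleR_opalg :: "real \<Rightarrow> 'a opalg \<Rightarrow> 'a opalg" is "(*\<^sub>R)" .
lift_definition norm_opalg :: "'a opalg \<Rightarrow> real" is op_norm .

definition sgn_opalg :: "'a opalg \<Rightarrow> 'a opalg" where "sgn_opalg A = inverse (norm A) *\<^sub>R A"
definition dist_opalg :: "'a opalg \<Rightarrow> 'a opalg \<Rightarrow> real" where "dist_opalg A B = norm (A - B)"
definition uniformity_opalg :: "('a opalg \<times> 'a opalg) filter" where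
  "uniformity_opalg = (INF e\<in>{0<..}. principal {(A, B). dist A B < e})"
definition open_opalg :: "'a opalg set \<Rightarrow> bool" where
  "open_opalg U \<longleftrightarrow> (\<forall>x\<in>U. eventually (\<lambda>(x', y). x' = x \<longrightarrow> y \<in> U) uniformity)"

instance
proof
  fix A B C :: "'a opalg" and r s :: real
  show "A + B + C = A + (B + C)" by transfer (rule add.assoc)
  show "A + B = B + A" by transfer (rule add.commute)
  show "0 + A = A" by transfer simp
  show "- A + A = 0" by transfer simp
  show "A - B = A + - B" by transfer simp
  show "r *\<^sub>R (A + B) = r *\<^sub>R A + r *\<^sub>R B" by transfer (rule scaleR_add_right)
  show "(r + s) *\<^sub>R A = r *\<^sub>R A + s *\<^sub>R A" by transfer (rule scaleR_add_left)
  show "r *\<^sub>R s *\<^sub>R A = (r * s) *\<^sub>R A" by transfer simp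
  show "1 *\<^sub>R A = A" by transfer simp
  show "A * B * C = A * (B * C)" by transfer (rule matrix_mul_assoc[symmetric])
  show "(A + B) * C = A * C + B * C" by transfer
      (simp add: vec_eq_iff matrix_matrix_mult_def sum.distrib algebra_simps)
  show "A * (B + C) = A * B + A * C" by transfer (rule matrix_add_ldistrib)
  show "r *\<^sub>R A * B = r *\<^sub>R (A * B)" by transfer
      (simp add: vec_eq_iff matrix_matrix_mult_def scaleR_sum_right)
  show "A * r *\<^sub>R B = r *\<^sub>R (A * B)" by transfer
      (simp add: vec_eq_iff matrix_matrix_mult_def scaleR_sum_right)
  show "1 * A = A" by transfer simp
  show "A * 1 = A" by transfer simp
  show "(0 :: 'a opalg) \<noteq> 1"
    by transfer (metis op_norm_0 op_norm_mat_1 zero_neq_one)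
  show "norm A = 0 \<longleftrightarrow> A = 0" by transfer (rule op_norm_eq_0)
  show "norm (A + B) \<le> norm A + norm B" by transfer (rule op_norm_triangle)
  show "norm (r *\<^sub>R A) = \<bar>r\<bar> * norm A" by transfer (rule op_norm_scaleR)
  show "norm (A * B) \<le> norm A * norm B" by transfer (rule op_norm_mult)
  show "norm (1 :: 'a opalg) = 1" by transfer (rule op_norm_mat_1)
qed (fact sgn_opalg_def dist_opalg_def uniformity_opalg_def open_opalg_def)+

end

lemma bounded_linear_mat_of: "bounded_linear (mat_of :: 'n::finite opalg \<Rightarrow> _)"
  by (rule bounded_linear_intro[where K = "real CARD('n) * real CARD('n)"]; transfer)
    (use norm_le_op_norm in \<open>auto simp: mult.commute\<close>)

lemma bounded_linear_op_of: "bounded_linear (op_of :: _ \<Rightarrow> 'n::finite opalg)"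
  by (rule bounded_linear_intro[where K = "real CARD('n) * real CARD('n)"])
    (use op_norm_le_norm in \<open>auto simp: mult.commute plus_opalg.abs_eq scaleR_opalg.abs_eq norm_opalg.abs_eq\<close>)

text \<open>A Cauchy sequence is moved to the complete matrix type, and its limit is moved
  back.\<close>

instance opalg :: (finite) banach
proof
  fix X :: "nat \<Rightarrow> 'a opalg"
  assume "Cauchy X"
  then have "convergent (\<lambda>n. mat_of (X n))"
    by (intro Cauchy_convergent bounded_linear.Cauchy[OF bounded_linear_mat_of])
  then obtain L where "(\<lambda>n. mat_of (X n)) \<longlonglongrightarrow> L" by (auto simp: convergent_def)
  from bounded_linear.tendsto[OF bounded_linear_op_of this]
  show "convergent X" by (auto simp: convergent_def mat_of_inverse)
qed

text \<open>The series in \<open>mexp\<close> is summed in the Frobenius norm, the one behind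
  \<open>exp\<close> in the operator norm; the bounded linear map \<open>mat_of\<close> carries the
  latter termwise to the former.\<close>

lemma mexp_eq: "mexp A = mat_of (exp (op_of A))"
proof -
  have pow: "((**) A ^^ n) (mat 1) = mat_of (op_of A ^ n)" for n
    by (induction n) (auto simp: one_opalg.rep_eq times_opalg.rep_eq op_of_inverse)
  have "(\<lambda>n. mat_of (op_of A ^ n /\<^sub>R fact n)) sums mat_of (exp (op_of A))"
    by (intro bounded_linear.sums[OF bounded_linear_mat_of] exp_converges)
  then show ?thesis
    unfolding mexp_def pow by (simp add: sums_iff scaleR_opalg.rep_eq inverse_eq_divide)
qed

section \<open>Locality of fermionic operators\<close>

lemma dagger_mult: "dagger (A ** B) = dagger B ** dagger A"
  for A :: "complex ^ 'n ^ 'm" and B :: "complex ^ 'k ^ 'n"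
  by (simp add: dagger_def matrix_matrix_mult_def vec_eq_iff mult.commute)

lemma dagger_uminus: "dagger (- A) = - dagger A"
  by (simp add: dagger_def vec_eq_iff)

lemma matrix_mult_minus_left: "(- A) ** B = - (A ** B)"
  for A :: "complex ^ 'n ^ 'm" and B :: "complex ^ 'k ^ 'n"
  by (simp add: matrix_matrix_mult_def vec_eq_iff sum_negf)

lemma matrix_mult_add_left: "(A + B) ** C = A ** C + B ** C"
  for A B :: "complex ^ 'n ^ 'm" and C :: "complex ^ 'k ^ 'n"
  by (simp add: matrix_matrix_mult_def vec_eq_iff sum.distrib distrib_right)

lemma cscale_mult_left: "cscale c A ** B = cscale c (A ** B)"
  for A :: "complex ^ 'n ^ 'm" and B :: "complex ^ 'k ^ 'n"
  by (simp add: cscale_def matrix_matrix_mult_def vec_eq_iff sum_distrib_left mult.assoc)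

lemma cscale_mult_right: "A ** cscale c B = cscale c (A ** B)"
  for A :: "complex ^ 'n ^ 'm" and B :: "complex ^ 'k ^ 'n"
  by (simp add: cscale_def matrix_matrix_mult_def vec_eq_iff sum_distrib_left mult_ac)

section \<open>Anticommutation relations at distinct sites\<close>

definition jw_sign :: "'a::{finite,linorder} \<Rightarrow> 'a set \<Rightarrow> complex" where
  "jw_sign x S = (-1) ^ card {y \<in> S. y < x}"

lemma jw_sign_remove:
  assumes "y \<in> S"
  shows "jw_sign x (S - {y}) = (if y < x then - jw_sign x S else jw_sign x S)"
proof (cases "y < x")
  case True
  then have "{z \<in> S. z < x} = insert y {z \<in> S - {y}. z < x}" using assms by auto
  then show ?thesis using True by (simp add: jw_sign_def)
next
  case False
  then have "{z \<in> S - {y}. z < x} = {z \<in> S. z < x}" by auto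
  then show ?thesis using False by (simp add: jw_sign_def)
qed

lemma annihilation_entry:
  "annihilation x $ S' $ S = (if x \<in> S \<and> S' = S - {x} then jw_sign x S else 0)"
  by (simp add: annihilation_def jw_sign_def)

lemma creation_entry:
  "creation x $ S' $ S = (if x \<in> S' \<and> S = S' - {x} then jw_sign x S' else 0)"
  by (simp add: creation_def dagger_def annihilation_def jw_sign_def)

lemma annihilation_mult_entry:
  "(annihilation x ** annihilation y) $ S' $ S =
    (if y \<in> S \<and> x \<in> S - {y} \<and> S' = S - {y} - {x} then jw_sign x (S - {y}) * jw_sign y S else 0)"
proof -
  have "(annihilation x ** annihilation y) $ S' $ S =
    (\<Sum>U\<in>UNIV. if U = S - {y} then
      (if y \<in> S then annihilation x $ S' $ (S - {y}) * jw_sign y S else 0) else 0)"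
    unfolding matrix_matrix_mult_def vec_lambda_beta
    by (intro sum.cong refl) (simp add: annihilation_entry[of y])
  then show ?thesis by (simp add: annihilation_entry)
qed

text \<open>Both orders remove the two sites from \<open>S\<close>. Removing the smaller site first
  flips the sign seen by the larger one, while removing the larger first changes nothing, so the
  products differ by exactly one sign.\<close>

lemma annihilation_anticommute:
  assumes "x \<noteq> y"
  shows "annihilation x ** annihilation y = - (annihilation y ** annihilation x)"
proof -
  have "(annihilation x ** annihilation y) $ S' $ S = - (annihilation y ** annihilation x) $ S' $ S"
    for S' S :: "'a set"
  proof (cases "x \<in> S \<and> y \<in> S \<and> S' = S - {x, y}")
    case True
    moreover have "S - {y} - {x} = S - {x, y}" "S - {x} - {y} = S - {x, y}" by auto
    ultimately have "(annihilation x ** annihilation y) $ S' $ S = jw_sign x (S - {y}) * jw_sign y S"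
      "(annihilation y ** annihilation x) $ S' $ S = jw_sign y (S - {x}) * jw_sign x S"
      unfolding annihilation_mult_entry using assms by simp_all
    then show ?thesis
      using True assms less_linear[of x y] less_asym[of x y] by (auto simp: jw_sign_remove)
  next
    case False
    then have "(annihilation x ** annihilation y) $ S' $ S = 0"
      "(annihilation y ** annihilation x) $ S' $ S = 0"
      unfolding annihilation_mult_entry by auto
    then show ?thesis by simp
  qed
  then show ?thesis by (simp add: vec_eq_iff)
qed

lemma creation_annihilation_entry:
  assumes "x \<noteq> y"
  shows "(creation x ** annihilation y) $ S' $ S =
    (if x \<in> S' \<and> y \<in> S \<and> S' - {x} = S - {y} then jw_sign x S' * jw_sign y S else 0)"
proof -
  have "(creation x ** annihilation y) $ S' $ S =
    (\<Sum>U\<in>UNIV. if U = S - {y} then (if y \<in> S then creation x $ S' $ (S - {y}) * jw_sign y S else 0) else 0)"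
    unfolding matrix_matrix_mult_def vec_lambda_beta
    by (intro sum.cong refl) (simp add: annihilation_entry[of y])
  then show ?thesis by (auto simp: creation_entry)
qed

text \<open>The intermediate state is \<open>insert x S\<close>. The condition is brought into the
  form used in \<open>creation_annihilation_entry\<close>, so that both products are nonzero at the
  same entries and only signs remain to be compared.\<close>

lemma annihilation_creation_entry:
  assumes "x \<noteq> y"
  shows "(annihilation y ** creation x) $ S' $ S =
    (if x \<in> S' \<and> y \<in> S \<and> S' - {x} = S - {y} then
      jw_sign y (insert x S) * jw_sign x (insert x S) else 0)"
proof -
  have "(annihilation y ** creation x) $ S' $ S =
    (\<Sum>U\<in>UNIV. if U = insert x S then
      (if x \<notin> S then annihilation y $ S' $ (insert x S) * jw_sign x (insert x S) else 0) else 0)"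
    unfolding matrix_matrix_mult_def vec_lambda_beta
    by (intro sum.cong refl) (auto simp: creation_entry)
  then have "(annihilation y ** creation x) $ S' $ S =
    (if x \<notin> S \<and> y \<in> insert x S \<and> S' = insert x S - {y} then
      jw_sign y (insert x S) * jw_sign x (insert x S) else 0)"
    by (simp add: annihilation_entry)
  moreover have "x \<notin> S \<and> y \<in> insert x S \<and> S' = insert x S - {y} \<longleftrightarrow>
      x \<in> S' \<and> y \<in> S \<and> S' - {x} = S - {y}"
    using assms by blast
  ultimately show ?thesis by (simp only:)
qed

lemma creation_annihilation_anticommute:
  assumes "x \<noteq> y"
  shows "creation x ** annihilation y = - (annihilation y ** creation x)"
proof -
  have "(creation x ** annihilation y) $ S' $ S = - (annihilation y ** creation x) $ S' $ S"
    for S' S :: "'a set"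
  proof (cases "x \<in> S' \<and> y \<in> S \<and> S' - {x} = S - {y}")
    case True
    \<comment> \<open>Both outer states arise from \<open>insert x S\<close> by removing one site,
      so \<open>jw_sign_remove\<close> applies to each, and exactly one of the two signs
      flips.\<close>
    then have S': "S' = insert x S - {y}" "S = insert x S - {x}" using assms by auto
    have "jw_sign x S' = (if y < x then - jw_sign x (insert x S) else jw_sign x (insert x S))"
      unfolding S'(1) using True by (intro jw_sign_remove) auto
    moreover have "jw_sign y S = (if x < y then - jw_sign y (insert x S) else jw_sign y (insert x S))"
      by (subst S'(2)) (intro jw_sign_remove, simp)
    ultimately show ?thesis
      using True assms less_linear[of x y] less_asym[of x y]
      by (auto simp: creation_annihilation_entry annihilation_creation_entry)
  next
    case False
    then have "(creation x ** annihilation y) $ S' $ S = 0"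
      "(annihilation y ** creation x) $ S' $ S = 0"
      unfolding creation_annihilation_entry[OF assms] annihilation_creation_entry[OF assms]
      by (simp_all only: if_False)
    then show ?thesis by simp
  qed
  then show ?thesis by (simp add: vec_eq_iff)
qed

lemma creation_anticommute:
  assumes "x \<noteq> y"
  shows "creation x ** creation y = - (creation y ** creation x)"
  using arg_cong[OF annihilation_anticommute[of y x], of dagger] assms
  by (simp add: creation_def dagger_mult dagger_uminus)

section \<open>Parity automorphism and commutation of disjoint local operators\<close>

lemma parity_entry_left: "(parity ** A) $ S' $ S = (-1) ^ card S' * A $ S' $ S"
proof -
  have "(parity ** A) $ S' $ S = (\<Sum>U\<in>UNIV. if U = S' then (-1) ^ card S' * A $ S' $ S else 0)"
    unfolding matrix_matrix_mult_def vec_lambda_beta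
    by (intro sum.cong refl) (simp add: parity_def)
  then show ?thesis by simp
qed

lemma parity_entry_right: "(A ** parity) $ S' $ S = A $ S' $ S * (-1) ^ card S"
proof -
  have "(A ** parity) $ S' $ S = (\<Sum>U\<in>UNIV. if U = S then A $ S' $ S * (-1) ^ card S else 0)"
    unfolding matrix_matrix_mult_def vec_lambda_beta
    by (intro sum.cong refl) (auto simp: parity_def)
  then show ?thesis by simp
qed

lemma parity_parity: "parity ** parity = mat 1"
  by (simp add: vec_eq_iff parity_entry_left)
    (simp add: parity_def mat_def flip: power_add mult_2)

lemma dagger_parity: "dagger parity = parity"
  by (simp add: vec_eq_iff dagger_def parity_def)

definition parity_conj :: "'a::finite fock_op \<Rightarrow> 'a fock_op" where
  "parity_conj A = parity ** A ** parity"

lemma parity_conj_annihilation: "parity_conj (annihilation x) = - annihilation x"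
proof -
  have "(-1) ^ card (S - {x}) * c * (-1) ^ card S = - c" if "x \<in> S" for S :: "'a set" and c :: complex
  proof -
    have "card S = Suc (card (S - {x}))" using that card_Suc_Diff1[of S x] by simp
    then show ?thesis by (simp flip: power_mult_distrib)
  qed
  then show ?thesis
    unfolding vec_eq_iff parity_conj_def parity_entry_left parity_entry_right annihilation_entry
    by (auto simp: annihilation_entry)
qed

lemma parity_conj_creation: "parity_conj (creation x) = - creation x"
  using arg_cong[OF parity_conj_annihilation[of x], of dagger]
  by (simp add: parity_conj_def creation_def dagger_mult dagger_parity dagger_uminus matrix_mul_assoc)

lemma parity_conj_mult: "parity_conj (A ** B) = parity_conj A ** parity_conj B"
proof -
  have "parity_conj A ** parity_conj B = parity ** A ** (parity ** parity) ** B ** parity"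
    by (simp add: parity_conj_def matrix_mul_assoc)
  then show ?thesis by (simp add: parity_parity parity_conj_def matrix_mul_assoc)
qed

text \<open>A creation or annihilation operator at a site outside \<open>X\<close> passes through the algebra of \<open>X\<close> at the cost of the
  parity automorphism, hence commutes with its even elements.\<close>

lemma mult_local_algebra_parity_conj:
  fixes C :: "'a::{finite,linorder} fock_op"
  assumes "A \<in> local_algebra X" and "x \<notin> X" and C: "C = annihilation x \<or> C = creation x"
  shows "C ** A = parity_conj A ** C"
  using assms(1)
proof induction
  case one
  show ?case by (simp add: parity_conj_def parity_parity)
next
  case (annih y)
  then have "x \<noteq> y" using assms(2) by auto
  then show ?case
    using C annihilation_anticommute[of x y] creation_annihilation_anticommute[of x y]
    by (auto simp: parity_conj_annihilation matrix_mult_minus_left)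
next
  case (creat y)
  then have "x \<noteq> y" using assms(2) by auto
  then show ?case
    using C creation_anticommute[of x y] creation_annihilation_anticommute[of y x]
    by (auto simp: parity_conj_creation matrix_mult_minus_left)
next
  case (scale A c)
  then show ?case by (simp add: parity_conj_def cscale_mult_left cscale_mult_right)
next
  case (add A B)
  then show ?case
    by (simp add: parity_conj_def matrix_add_ldistrib matrix_mult_add_left)
next
  case (mult A B)
  have "C ** (A ** B) = (C ** A) ** B" by (simp add: matrix_mul_assoc)
  also have "\<dots> = parity_conj A ** (C ** B)" unfolding mult.IH(1) by (simp add: matrix_mul_assoc)
  finally show ?case unfolding mult.IH(2) by (simp add: matrix_mul_assoc parity_conj_mult)
qed

text \<open>An even \<open>B\<close> commutes with every generator of the algebra of
  \<open>X\<close>, and commutation passes to scalings, sums and products. Evenness is asked of one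
  factor only, so that \<open>A\<close> can be the observable and \<open>B\<close> an interaction
  term.\<close>

lemma local_algebra_commute:
  fixes A B :: "'a::{finite,linorder} fock_op"
  assumes "A \<in> local_algebra X" "B \<in> local_algebra Y" "even_op B" "X \<inter> Y = {}"
  shows "A ** B = B ** A"
proof -
  have "parity_conj B = B" using assms(3) by (simp add: even_op_def parity_conj_def)
  then have gen: "C ** B = B ** C" if "x \<in> X" "C = annihilation x \<or> C = creation x" for x C
    using mult_local_algebra_parity_conj[OF assms(2) _ that(2)] that(1) assms(4) by auto
  show ?thesis
    using assms(1)
  proof induction
    case (mult A A')
    have "A ** A' ** B = A ** (A' ** B)" by (simp add: matrix_mul_assoc)
    also have "\<dots> = (A ** B) ** A'" by (simp add: mult matrix_mul_assoc)
    finally show ?case by (simp add: mult matrix_mul_assoc)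
  qed (auto simp: gen cscale_mult_left cscale_mult_right matrix_add_ldistrib matrix_mult_add_left)
qed

section \<open>Flows generated by contractive exponentials\<close>

lemma exp_scaleR_commute:
  fixes K A :: "'b::{real_normed_algebra_1,banach}"
  assumes "K * A = A * K"
  shows "exp (t *\<^sub>R K) * A = A * exp (t *\<^sub>R K)"
proof -
  have pow: "(t *\<^sub>R K) ^ n * A = A * (t *\<^sub>R K) ^ n" for n
  proof -
    have "K ^ n * A = A * K ^ n"
    proof (induction n)
      case (Suc n)
      have "K ^ Suc n * A = K * (K ^ n * A)" by (simp add: mult.assoc)
      also have "\<dots> = (K * A) * K ^ n" by (simp add: Suc mult.assoc)
      also have "\<dots> = A * K ^ Suc n" by (simp add: assms mult.assoc)
      finally show ?case .
    qed simp
    then show ?thesis by (simp add: scaleR_power)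
  qed
  have "exp (t *\<^sub>R K) * A = (\<Sum>n. ((t *\<^sub>R K) ^ n /\<^sub>R fact n) * A)"
    unfolding exp_def by (rule suminf_mult2[OF summable_exp_generic])
  also have "\<dots> = (\<Sum>n. A * ((t *\<^sub>R K) ^ n /\<^sub>R fact n))" by (simp only: mult_scaleR_left mult_scaleR_right pow)
  also have "\<dots> = A * exp (t *\<^sub>R K)"
    unfolding exp_def by (rule suminf_mult[OF summable_exp_generic])
  finally show ?thesis .
qed

definition flow :: "'b::{real_normed_algebra_1,banach} \<Rightarrow> real \<Rightarrow> 'b \<Rightarrow> 'b" where
  "flow K t A = exp (t *\<^sub>R K) * A * exp (- t *\<^sub>R K)"

text \<open>In operator terms \<open>K = i H\<close>, and this condition replaces the unitarity of \<open>exp (i t H)\<close>.\<close>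

definition contractive :: "'b::{real_normed_algebra_1,banach} \<Rightarrow> bool" where
  "contractive K \<longleftrightarrow> (\<forall>t. norm (exp (t *\<^sub>R K)) \<le> 1)"

definition comm :: "'b::ring \<Rightarrow> 'b \<Rightarrow> 'b" where
  "comm A B = A * B - B * A"

lemma exp_scaleR_inverse:
  "exp (t *\<^sub>R K) * exp (- t *\<^sub>R K) = 1" "exp (- t *\<^sub>R K) * exp (t *\<^sub>R K) = 1"
  for K :: "'b::{real_normed_algebra_1,banach}"
  using exp_minus_inverse[of "t *\<^sub>R K"] exp_minus_inverse[of "- t *\<^sub>R K"] by simp_all

lemma exp_scaleR_cancel:
  "exp (t *\<^sub>R K) * (exp (- t *\<^sub>R K) * A) = A" "exp (- t *\<^sub>R K) * (exp (t *\<^sub>R K) * A) = A"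
  for K :: "'b::{real_normed_algebra_1,banach}"
  by (simp_all add: mult.assoc[symmetric] exp_scaleR_inverse del: scaleR_minus_left)

lemma flow_0 [simp]: "flow K 0 A = A" by (simp add: flow_def)

lemma flow_mult: "flow K t (A * B) = flow K t A * flow K t B"
  unfolding flow_def mult.assoc exp_scaleR_cancel ..

lemma flow_diff: "flow K t (A - B) = flow K t A - flow K t B"
  by (simp add: flow_def algebra_simps)

lemma flow_sum: "flow K t (\<Sum>i\<in>I. A i) = (\<Sum>i\<in>I. flow K t (A i))"
  by (simp add: flow_def sum_distrib_left sum_distrib_right)

lemma flow_comm: "flow K t (comm A B) = comm (flow K t A) (flow K t B)"
  by (simp add: comm_def flow_diff flow_mult)

lemma flow_uminus_flow: "flow (- K) t (flow K t A) = A"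
proof -
  have "flow (- K) t (flow K t A)
    = exp (- t *\<^sub>R K) * (exp (t *\<^sub>R K) * (A * (exp (- t *\<^sub>R K) * exp (t *\<^sub>R K))))"
    by (simp add: flow_def mult.assoc)
  then show ?thesis by (simp only: exp_scaleR_inverse exp_scaleR_cancel mult_1_right)
qed

lemma flow_flow_uminus: "flow K t (flow (- K) t A) = A"
  using flow_uminus_flow[of "- K" t A] by simp

lemma flow_cong_commute:
  assumes "K * A = A * K"
  shows "flow K t A = A"
  unfolding flow_def exp_scaleR_commute[OF assms] mult.assoc exp_scaleR_inverse by simp

lemma contractiveD: "contractive K \<Longrightarrow> norm (exp (t *\<^sub>R K)) \<le> 1"
  by (simp add: contractive_def)

lemma contractive_uminus: "contractive K \<Longrightarrow> contractive (- K)"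
  unfolding contractive_def
proof
  fix t assume "\<forall>t. norm (exp (t *\<^sub>R K)) \<le> 1"
  from this[rule_format, of "- t"] show "norm (exp (t *\<^sub>R - K)) \<le> 1" by simp
qed

lemma norm_flow_le:
  assumes "contractive K"
  shows "norm (flow K t A) \<le> norm A"
proof -
  have "norm (flow K t A) \<le> norm (exp (t *\<^sub>R K)) * norm A * norm (exp (- t *\<^sub>R K))"
    unfolding flow_def
    by (rule order_trans[OF norm_mult_ineq mult_right_mono[OF norm_mult_ineq norm_ge_zero]])
  also have "\<dots> \<le> 1 * norm A * 1"
    using assms by (intro mult_mono contractiveD) auto
  finally show ?thesis by simp
qed

text \<open>The inverse flow is contractive as well, and the two one-sided bounds combine to an
  isometry.\<close>

lemma norm_flow:
  assumes "contractive K"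
  shows "norm (flow K t A) = norm A"
  using norm_flow_le[OF assms, of t A] norm_flow_le[OF contractive_uminus[OF assms], of t "flow K t A"]
  by (simp add: flow_uminus_flow)

lemma norm_comm_le: "norm (comm A B) \<le> 2 * norm A * norm B"
  for A :: "'b::real_normed_algebra"
proof -
  have "norm (comm A B) \<le> norm (A * B) + norm (B * A)"
    unfolding comm_def by (rule norm_triangle_ineq4)
  also have "\<dots> \<le> norm A * norm B + norm B * norm A"
    by (intro add_mono norm_mult_ineq)
  finally show ?thesis by simp
qed

lemma comm_sum_left: "comm (\<Sum>i\<in>I. A i) B = (\<Sum>i\<in>I. comm (A i) B)"
  by (simp add: comm_def sum_distrib_left sum_distrib_right sum_subtractf)

lemma comm_swap: "comm A B = - comm B A" by (simp add: comm_def)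

text \<open>The argument may depend on time, as is needed to differentiate a flow of a flow. The
  generator is differentiated out on the inner side of each exponential, so that the commutator
  forms inside the flow.\<close>

lemma flow_has_vector_derivative:
  assumes "(f has_vector_derivative f') (at t)"
  shows "((\<lambda>t. flow K t (f t)) has_vector_derivative flow K t (comm K (f t) + f')) (at t)"
proof -
  have "((\<lambda>t. exp (t *\<^sub>R K) * f t * exp (t *\<^sub>R (- K))) has_vector_derivative
      exp (t *\<^sub>R K) * f t * (- K * exp (t *\<^sub>R - K))
        + (exp (t *\<^sub>R K) * f' + exp (t *\<^sub>R K) * K * f t) * exp (t *\<^sub>R - K)) (at t)"
    by (intro has_vector_derivative_mult exp_scaleR_has_vector_derivative_right
        exp_scaleR_has_vector_derivative_left assms)
  then show ?thesis
    by (simp add: flow_def comm_def algebra_simps)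
qed

lemma continuous_on_flow [continuous_intros]:
  "continuous_on S (\<lambda>t. flow K t A)"
proof -
  have "((\<lambda>t. flow K t A) has_vector_derivative flow K t (comm K A + 0)) (at t)" for t
    by (rule flow_has_vector_derivative) simp
  then show ?thesis
    by (meson continuous_at_imp_continuous_on has_vector_derivative_continuous)
qed

text \<open>The path \<open>\<beta> s\<close> interpolates between \<open>B\<close> and the doubly
  evolved operator. Its derivative is, up to an isometry and a sign, the commutator bounded by
  \<open>\<phi>' s\<close>, and the mean value inequality compares it with the primitive
  \<open>\<phi>\<close>.\<close>

lemma norm_flow_flow_diff_le:
  fixes K L B :: "'b::{real_normed_algebra_1,banach}"
  assumes K: "contractive K" and L: "contractive L" and t: "0 \<le> t"
    and bound: "\<And>s. 0 \<le> s \<Longrightarrow> s \<le> t \<Longrightarrow> norm (comm (flow K s (K - L)) B) \<le> \<phi>' s"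
    and deriv: "\<And>s. 0 \<le> s \<Longrightarrow> s \<le> t \<Longrightarrow> (\<phi> has_vector_derivative \<phi>' s) (at s within {0..t})"
  shows "norm (flow L t (flow (- K) t B) - B) \<le> \<phi> t - \<phi> 0"
\<comment> \<open>The mean value rule used below needs a nondegenerate interval; at
  \<open>t = 0\<close> both sides vanish.\<close>
proof (cases "t = 0")
  case False
  define \<beta> where "\<beta> s = flow L s (flow (- K) s B)" for s
  define \<beta>' where "\<beta>' s = flow L s (comm (L - K) (flow (- K) s B))" for s
  have d: "(\<beta> has_vector_derivative \<beta>' s) (at s)" for s
  proof -
    have "((\<lambda>s. flow (- K) s B) has_vector_derivative flow (- K) s (comm (- K) B + 0)) (at s)"
      by (rule flow_has_vector_derivative) simp
    from flow_has_vector_derivative[OF this, of L]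
    have "(\<beta> has_vector_derivative flow L s (comm L (flow (- K) s B) + flow (- K) s (comm (- K) B))) (at s)"
      unfolding \<beta>_def by simp
    moreover have "flow (- K) s (comm (- K) B) = comm (- K) (flow (- K) s B)"
      by (simp only: flow_comm flow_cong_commute)
    ultimately show ?thesis
      by (simp add: \<beta>'_def) (simp add: comm_def algebra_simps)
  qed
  \<comment> \<open>Both flows are isometries: the outer \<open>flow L s\<close> is dropped and
    \<open>flow K s\<close> inserted, which undoes the backward evolution of \<open>B\<close> and
    moves the time dependence onto \<open>K - L\<close>.\<close>
  have n: "norm (\<beta>' s) = norm (comm (flow K s (K - L)) B)" for s
  proof -
    have "norm (\<beta>' s) = norm (flow K s (comm (L - K) (flow (- K) s B)))"
      by (simp add: \<beta>'_def norm_flow K L)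
    also have "flow K s (comm (L - K) (flow (- K) s B)) = comm (flow K s (L - K)) B"
      by (simp add: flow_comm flow_flow_uminus)
    also have "\<dots> = - comm (flow K s (K - L)) B"
      by (simp add: flow_diff comm_def algebra_simps)
    finally show ?thesis by simp
  qed
  have "norm (\<beta> t - \<beta> 0) \<le> \<phi> t - \<phi> 0"
  proof (rule differentiable_bound_general[where f' = \<beta>' and \<phi>' = \<phi>'])
    show "0 < t" using t False by simp
    show "continuous_on {0..t} \<beta>"
      by (meson d continuous_at_imp_continuous_on has_vector_derivative_continuous)
    show "continuous_on {0..t} \<phi>"
      unfolding continuous_on_eq_continuous_within
    proof
      fix s assume "s \<in> {0..t}"
      then show "continuous (at s within {0..t}) \<phi>"
        by (intro has_vector_derivative_continuous[OF deriv]) simp_all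
    qed
    show "(\<phi> has_vector_derivative \<phi>' x) (at x)" if "0 < x" "x < t" for x
      using deriv[of x] that by (simp add: at_within_Icc_at)
    show "norm (\<beta>' x) \<le> \<phi>' x" if "0 < x" "x < t" for x
      unfolding n using that by (intro bound) simp_all
  qed (rule d)
  then show ?thesis by (simp add: \<beta>_def)
qed simp

text \<open>Write \<open>V = e\<^bsup>tK\<^esup> e\<^bsup>-tL\<^esup>\<close>; then \<open>flow K t A = V (flow L t A) V\<^sup>-\<^sup>1\<close>, and conjugating the
  commutator by \<open>V\<^sup>-\<^sup>1\<close> moves the whole time dependence caused by \<open>K - L\<close> onto \<open>B\<close>.\<close>

lemma norm_comm_flow_le:
  fixes K L A B :: "'b::{real_normed_algebra_1,banach}"
  assumes K: "contractive K" and L: "contractive L" and t: "0 \<le> t"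
    and bound: "\<And>s. 0 \<le> s \<Longrightarrow> s \<le> t \<Longrightarrow> norm (comm (flow K s (K - L)) B) \<le> \<phi>' s"
    and deriv: "\<And>s. 0 \<le> s \<Longrightarrow> s \<le> t \<Longrightarrow> (\<phi> has_vector_derivative \<phi>' s) (at s within {0..t})"
  shows "norm (comm (flow K t A) B) \<le> norm (comm (flow L t A) B) + 2 * norm A * (\<phi> t - \<phi> 0)"
proof -
  define B' where "B' = flow L t (flow (- K) t B)"
  have "norm (comm (flow K t A) B) = norm (flow L t (flow (- K) t (comm (flow K t A) B)))"
    by (simp add: norm_flow K L contractive_uminus)
  also have "\<dots> = norm (comm (flow L t A) B')"
    by (simp add: flow_comm flow_uminus_flow B'_def)
  also have "comm (flow L t A) B' = comm (flow L t A) B + comm (flow L t A) (B' - B)"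
    by (simp add: comm_def algebra_simps)
  also have "norm \<dots> \<le> norm (comm (flow L t A) B) + norm (comm (flow L t A) (B' - B))"
    by (rule norm_triangle_ineq)
  also have "norm (comm (flow L t A) (B' - B)) \<le> 2 * norm A * norm (B' - B)"
    using norm_comm_le[of "flow L t A" "B' - B"] by (simp add: norm_flow L)
  also have "norm (B' - B) \<le> \<phi> t - \<phi> 0"
    unfolding B'_def by (rule norm_flow_flow_diff_le[OF K L t bound deriv])
  finally show ?thesis by (simp add: mult_left_mono)
qed

text \<open>This is Duhamel's formula as a norm bound. The perturbation \<open>K - L\<close> meets
  only the evolution under \<open>L\<close>, so a propagation estimate for the truncated dynamics
  suffices. It is \<open>norm_flow_flow_diff_le\<close> with \<open>- L\<close> and
  \<open>- K\<close> in the roles of \<open>K\<close> and \<open>L\<close>, transported by the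
  isometry \<open>flow K t\<close>.\<close>

lemma norm_flow_diff_le:
  fixes K L B :: "'b::{real_normed_algebra_1,banach}"
  assumes K: "contractive K" and L: "contractive L" and t: "0 \<le> t"
    and bound: "\<And>s. 0 \<le> s \<Longrightarrow> s \<le> t \<Longrightarrow> norm (comm (K - L) (flow L s A)) \<le> \<phi>' s"
    and deriv: "\<And>s. 0 \<le> s \<Longrightarrow> s \<le> t \<Longrightarrow> (\<phi> has_vector_derivative \<phi>' s) (at s within {0..t})"
  shows "norm (flow K t A - flow L t A) \<le> \<phi> t - \<phi> 0"
proof -
  have "norm (flow (- K) t (flow (- (- L)) t A) - A) \<le> \<phi> t - \<phi> 0"
  proof (rule norm_flow_flow_diff_le[OF _ _ t _ deriv])
    fix s assume "0 \<le> s" "s \<le> t"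
    have "flow L s (comm (flow (- L) s (- L - - K)) A) = comm (K - L) (flow L s A)"
      by (simp add: flow_comm flow_flow_uminus)
    then have "norm (comm (flow (- L) s (- L - - K)) A) = norm (comm (K - L) (flow L s A))"
      using norm_flow[OF L, of s "comm (flow (- L) s (- L - - K)) A"] by (simp only:)
    with bound[OF \<open>0 \<le> s\<close> \<open>s \<le> t\<close>]
    show "norm (comm (flow (- L) s (- L - - K)) A) \<le> \<phi>' s"
      by (simp only:)
  qed (intro contractive_uminus K L)+
  moreover have "flow K t (flow (- K) t (flow L t A) - A) = flow L t A - flow K t A"
    by (simp add: flow_diff flow_flow_uminus)
  then have "norm (flow (- K) t (flow L t A) - A) = norm (flow L t A - flow K t A)"
    using norm_flow[OF K, of t "flow (- K) t (flow L t A) - A"] by (simp only:)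
  ultimately show ?thesis
    by (simp add: norm_minus_commute)
qed

section \<open>Lieb-Robinson bounds\<close>

lemma exp_has_integral:
  fixes c t :: real
  assumes "c \<noteq> 0" "0 \<le> t"
  shows "((\<lambda>s. exp (c * s)) has_integral (exp (c * t) - 1) / c) {0..t}"
proof -
  have "((\<lambda>s. exp (c * s)) has_integral exp (c * t) / c - exp (c * 0) / c) {0..t}"
    using assms by (intro fundamental_theorem_of_calculus)
      (auto intro!: derivative_eq_intros simp flip: has_real_derivative_iff_has_vector_derivative)
  then show ?thesis by (simp add: diff_divide_distrib)
qed

text \<open>Comparison with the supersolution \<open>q i * exp (c * t)\<close>: each application of the integral inequality
  improves the a priori error \<open>M\<close> to the next term of an exponential series.\<close>

lemma gronwall_system:
  fixes u :: "'i \<Rightarrow> real \<Rightarrow> real"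
  assumes cont: "\<And>i. i \<in> I \<Longrightarrow> continuous_on {0..} (u i)"
    and M: "\<And>i t. i \<in> I \<Longrightarrow> 0 \<le> t \<Longrightarrow> u i t \<le> M" "0 \<le> M"
    and b: "\<And>i j. i \<in> I \<Longrightarrow> j \<in> I \<Longrightarrow> 0 \<le> b i j"
    and B: "\<And>i. i \<in> I \<Longrightarrow> (\<Sum>j\<in>I. b i j) \<le> B"
    and q: "\<And>i. i \<in> I \<Longrightarrow> 0 \<le> q i"
    and c: "0 < c"
    and ineq: "\<And>i t. i \<in> I \<Longrightarrow> 0 \<le> t \<Longrightarrow>
      u i t \<le> q i + (\<Sum>j\<in>I. b i j * integral {0..t} (u j))"
    and super: "\<And>i. i \<in> I \<Longrightarrow> (\<Sum>j\<in>I. b i j * q j) \<le> c * q i"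
    and i: "i \<in> I" and t: "0 \<le> t"
  shows "u i t \<le> q i * exp (c * t)"
proof -
  have iter: "u i t \<le> q i * exp (c * t) + M * ((B * t) ^ n / fact n)"
    if "i \<in> I" "0 \<le> t" for n i t
    using that
  proof (induction n arbitrary: i t)
    case 0
    have "0 \<le> q i * exp (c * t)" using q 0 by simp
    with M(1)[OF 0] show ?case by simp
  next
    case (Suc n)
    have int: "integral {0..t} (u j)
        \<le> q j * ((exp (c * t) - 1) / c) + M * B ^ n * (t ^ Suc n / fact (Suc n))" if j: "j \<in> I" for j
    proof (rule has_integral_le)
      show "(u j has_integral integral {0..t} (u j)) {0..t}"
        by (intro integrable_integral integrable_continuous_interval continuous_on_subset[OF cont[OF j]]) auto
      have "((\<lambda>s. s ^ n / fact n) has_integral t ^ Suc n / fact (Suc n) - 0 ^ Suc n / fact (Suc n)) {0..t}"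
      proof (rule fundamental_theorem_of_calculus)
        fix s :: real
        have "((\<lambda>s. s ^ Suc n / fact (Suc n)) has_real_derivative
            real (Suc n) * s ^ n / fact (Suc n)) (at s within {0..t})"
          using DERIV_cdivide[OF DERIV_pow[of "Suc n" s "{0..t}"], of "fact (Suc n)"] by (simp del: fact_Suc of_nat_Suc power_Suc)
        moreover have "real (Suc n) * s ^ n / fact (Suc n) = s ^ n / fact n"
          by (simp add: field_simps del: of_nat_Suc)
        ultimately show "((\<lambda>s. s ^ Suc n / fact (Suc n)) has_vector_derivative s ^ n / fact n)
            (at s within {0..t})"
          by (simp add: has_real_derivative_iff_has_vector_derivative)
      qed (use Suc in auto)
      then show "((\<lambda>s. q j * exp (c * s) + M * B ^ n * (s ^ n / fact n)) has_integral
          q j * ((exp (c * t) - 1) / c) + M * B ^ n * (t ^ Suc n / fact (Suc n))) {0..t}"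
        using Suc c by (intro has_integral_add has_integral_mult_right exp_has_integral) auto
      show "u j s \<le> q j * exp (c * s) + M * B ^ n * (s ^ n / fact n)" if "s \<in> {0..t}" for s
        using Suc.IH[OF j, of s] that by (simp add: power_mult_distrib mult.assoc)
    qed
    have "u i t \<le> q i + (\<Sum>j\<in>I. b i j * integral {0..t} (u j))" by (rule ineq[OF Suc.prems])
    also have "\<dots> \<le> q i + (\<Sum>j\<in>I. b i j *
        (q j * ((exp (c * t) - 1) / c) + M * B ^ n * (t ^ Suc n / fact (Suc n))))"
      by (intro add_left_mono sum_mono mult_left_mono int b Suc.prems)
    also have "\<dots> = q i + (\<Sum>j\<in>I. b i j * q j) * ((exp (c * t) - 1) / c)
        + (\<Sum>j\<in>I. b i j) * (M * B ^ n * (t ^ Suc n / fact (Suc n)))"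
      by (simp only: distrib_left sum.distrib sum_distrib_right mult.assoc add.assoc)
    also have "\<dots> \<le> q i + c * q i * ((exp (c * t) - 1) / c)
        + B * (M * B ^ n * (t ^ Suc n / fact (Suc n)))"
    proof (intro add_mono order_refl mult_right_mono super B Suc.prems)
      have "0 \<le> (\<Sum>j\<in>I. b i j)" by (intro sum_nonneg b Suc.prems)
      then have "0 \<le> B" using B[OF Suc.prems(1)] by simp
      then show "0 \<le> M * B ^ n * (t ^ Suc n / fact (Suc n))" using M Suc.prems by simp
      show "0 \<le> (exp (c * t) - 1) / c" using c Suc.prems by simp
    qed
    \<comment> \<open>The integrated supersolution leaves \<open>- q i\<close>, which cancels the
      inhomogeneous term \<open>q i\<close>; so the supersolution reproduces itself.\<close>
    also have "c * q i * ((exp (c * t) - 1) / c) = q i * exp (c * t) - q i"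
      using c by (simp add: field_simps)
    also have "B * (M * B ^ n * (t ^ Suc n / fact (Suc n))) = M * ((B * t) ^ Suc n / fact (Suc n))"
      by (simp add: power_mult_distrib del: fact_Suc)
    finally show ?case by simp
  qed
  have "(\<lambda>n. q i * exp (c * t) + M * ((B * t) ^ n / fact n)) \<longlonglongrightarrow> q i * exp (c * t) + M * 0"
    using summable_LIMSEQ_zero[OF summable_exp_generic[of "B * t"]]
    by (intro tendsto_intros) (simp add: divide_inverse mult.commute)
  from LIMSEQ_le_const[OF this] iter[OF i t] show ?thesis by auto
qed

lemma flow_add:
  assumes "K * L = L * K"
  shows "flow (K + L) t A = flow K t (flow L t A)"
proof -
  have "exp (s *\<^sub>R K + s *\<^sub>R L) = exp (s *\<^sub>R K) * exp (s *\<^sub>R L)" for s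
    by (rule exp_add_commuting) (simp add: assms)
  \<comment> \<open>The reversed order is used for the inverse exponential on the right of the
    flow.\<close>
  moreover have "exp (s *\<^sub>R K + s *\<^sub>R L) = exp (s *\<^sub>R L) * exp (s *\<^sub>R K)" for s
    using exp_add_commuting[of "s *\<^sub>R L" "s *\<^sub>R K"] by (simp add: assms add.commute)
  ultimately show ?thesis
    by (metis (no_types, lifting) flow_def mult.assoc scaleR_add_right)
qed

text \<open>On the right each \<open>Z\<close> is counted once per point of
  \<open>Z \<inter> S\<close>, hence at least once. This turns sums over regions into sums anchored
  at sites, where decay assumptions apply.\<close>

lemma sum_le_sum_meeting:
  fixes f :: "'a::finite set \<Rightarrow> real"
  assumes "\<And>Z. Z \<in> \<Z> \<Longrightarrow> 0 \<le> f Z" "\<And>Z. Z \<in> \<Z> \<Longrightarrow> Z \<inter> S \<noteq> {}"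
  shows "(\<Sum>Z\<in>\<Z>. f Z) \<le> (\<Sum>x\<in>S. \<Sum>Z\<in>{Z\<in>\<Z>. x \<in> Z}. f Z)"
proof -
  have "(\<Sum>Z\<in>\<Z>. f Z) \<le> (\<Sum>Z\<in>\<Z>. \<Sum>x\<in>{x\<in>S. x \<in> Z}. f Z)"
  proof (rule sum_mono)
    fix Z assume Z: "Z \<in> \<Z>"
    then obtain x where "x \<in> Z" "x \<in> S" using assms(2) by blast
    then have "1 \<le> card {x\<in>S. x \<in> Z}" by (auto simp: Suc_le_eq card_gt_0_iff)
    then show "f Z \<le> (\<Sum>x\<in>{x\<in>S. x \<in> Z}. f Z)"
      using assms(1)[OF Z] mult_right_mono[of 1 "real (card {x\<in>S. x \<in> Z})" "f Z"] by simp
  qed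
  also have "\<dots> = (\<Sum>x\<in>S. \<Sum>Z\<in>{Z\<in>\<Z>. x \<in> Z}. f Z)"
    by (rule sum.swap_restrict) auto
  finally show ?thesis .
qed

text \<open>Here \<open>\<phi> Z\<close> stands for \<open>\<i>\<close> times an interaction term.
  Contractivity is assumed for every subfamily, since the comparison dynamics with some terms
  removed must also be isometric; \<open>convolution\<close> has constant 1 because the kernel is
  normalized.\<close>

locale lieb_robinson =
  fixes \<phi> :: "'a::finite set \<Rightarrow> 'b::{real_normed_algebra_1,banach}"
    and G :: "'a \<Rightarrow> 'a \<Rightarrow> real" and g :: real
  assumes contractive_sum: "contractive (\<Sum>Z\<in>\<Z>. \<phi> Z)"
    and disjoint_commute: "Z \<inter> Y = {} \<Longrightarrow> \<phi> Z * \<phi> Y = \<phi> Y * \<phi> Z"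
    and g_pos: "0 < g"
    and G_nonneg: "0 \<le> G x y"
    and convolution: "(\<Sum>z\<in>UNIV. G x z * G z y) \<le> G x y"
    and decay: "(\<Sum>Z | x \<in> Z \<and> y \<in> Z. norm (\<phi> Z)) \<le> g * G x y"
begin

definition boundary :: "'a set \<Rightarrow> 'a set" where
  "boundary X = {x \<in> X. \<exists>Z. x \<in> Z \<and> Z \<inter> (UNIV - X) \<noteq> {} \<and> \<phi> Z \<noteq> 0}"

text \<open>This is \<open>D(z)\<close> of the introduction.\<close>

definition tail :: "'a set \<Rightarrow> 'a \<Rightarrow> real" where
  "tail W x = (\<Sum>y\<in>-W. G x y)"

definition generator :: "'a set \<Rightarrow> 'b" where
  "generator W = (\<Sum>Z\<in>Pow W. \<phi> Z)"

text \<open>This is \<open>v_A\<close> of the introduction, with the truncated generator. The norms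
  stand inside the sum, so that summation over \<open>Y\<close> can be exchanged with time
  integration.\<close>

definition leak :: "'a set \<Rightarrow> 'b \<Rightarrow> real \<Rightarrow> real" where
  "leak W A t = (\<Sum>Y | \<not> Y \<subseteq> W. norm (comm (flow (generator W) t A) (\<phi> Y)))"

lemma tail_nonneg: "0 \<le> tail W x"
  by (simp add: tail_def G_nonneg sum_nonneg)

text \<open>A region not contained in \<open>W\<close> has a site outside \<open>W\<close>, so
  \<open>decay\<close> applies at the pair of \<open>x\<close> and that site.\<close>

lemma sum_norm_outside_le: "(\<Sum>Y | \<not> Y \<subseteq> W \<and> x \<in> Y. norm (\<phi> Y)) \<le> g * tail W x"
proof -
  have "(\<Sum>Y | \<not> Y \<subseteq> W \<and> x \<in> Y. norm (\<phi> Y))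
      \<le> (\<Sum>y\<in>-W. \<Sum>Y\<in>{Y\<in>{Y. \<not> Y \<subseteq> W \<and> x \<in> Y}. y \<in> Y}. norm (\<phi> Y))"
    by (rule sum_le_sum_meeting) auto
  also have "\<dots> \<le> (\<Sum>y\<in>-W. \<Sum>Y | x \<in> Y \<and> y \<in> Y. norm (\<phi> Y))"
    by (intro sum_mono sum_mono2) auto
  also have "\<dots> \<le> (\<Sum>y\<in>-W. g * G x y)" by (intro sum_mono decay)
  finally show ?thesis by (simp add: tail_def sum_distrib_left)
qed

text \<open>Exchanging the sums produces a chain \<open>G x z * G z y\<close>, which
  \<open>convolution\<close> collapses to \<open>G x y\<close>. This self-reproduction of the tail
  yields the supersolution.\<close>

lemma sum_norm_tail_le:
  "(\<Sum>Z | x \<in> Z. norm (\<phi> Z) * (\<Sum>z\<in>Z. tail W z)) \<le> g * tail W x"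
proof -
  have "(\<Sum>Z | x \<in> Z. norm (\<phi> Z) * (\<Sum>z\<in>Z. tail W z))
      = (\<Sum>Z | x \<in> Z. \<Sum>z\<in>{z\<in>UNIV. z \<in> Z}. norm (\<phi> Z) * tail W z)"
    by (simp add: sum_distrib_left)
  also have "\<dots> = (\<Sum>z\<in>UNIV. \<Sum>Z\<in>{Z\<in>{Z. x \<in> Z}. z \<in> Z}. norm (\<phi> Z) * tail W z)"
    by (rule sum.swap_restrict) auto
  also have "\<dots> = (\<Sum>z\<in>UNIV. (\<Sum>Z | x \<in> Z \<and> z \<in> Z. norm (\<phi> Z)) * tail W z)"
    by (simp add: sum_distrib_right)
  also have "\<dots> \<le> (\<Sum>z\<in>UNIV. g * G x z * tail W z)"
    by (intro sum_mono mult_right_mono decay tail_nonneg)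
  also have "\<dots> = (\<Sum>z\<in>UNIV. \<Sum>y\<in>-W. g * (G x z * G z y))"
    by (simp add: tail_def sum_distrib_left mult.assoc)
  also have "\<dots> = (\<Sum>y\<in>-W. \<Sum>z\<in>UNIV. g * (G x z * G z y))"
    by (rule sum.swap)
  also have "\<dots> = g * (\<Sum>y\<in>-W. \<Sum>z\<in>UNIV. G x z * G z y)"
    by (simp add: sum_distrib_left)
  also have "\<dots> \<le> g * tail W x"
    unfolding tail_def using g_pos by (intro mult_left_mono sum_mono convolution) auto
  finally show ?thesis .
qed

lemma norm_mult_tail_nonneg: "0 \<le> norm (\<phi> Z) * (\<Sum>z\<in>Z. tail W z)"
  by (intro mult_nonneg_nonneg sum_nonneg tail_nonneg norm_ge_zero)

lemma contractive_generator: "contractive (generator W)"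
  by (simp add: generator_def contractive_sum)

lemma continuous_on_comm_flow: "continuous_on S (\<lambda>t. norm (comm (flow K t A) B))"
  unfolding comm_def by (intro continuous_intros)

lemma continuous_on_leak: "continuous_on S (leak W A)"
  unfolding leak_def by (intro continuous_intros continuous_on_comm_flow)

text \<open>The generator without the terms in \<open>\<N>\<close> is the comparison dynamics in
  \<open>norm_comm_flow_le\<close>; the removed terms enter through their own leakage, integrated in
  time. The set \<open>\<N>\<close> stays free because it is chosen differently for interaction
  terms and for the observable.\<close>

lemma leak_le:
  assumes "\<N> \<subseteq> Pow W" "0 \<le> t"
  shows "leak W A t \<le> (\<Sum>Y | \<not> Y \<subseteq> W. norm (comm (flow (\<Sum>Z\<in>Pow W - \<N>. \<phi> Z) t A) (\<phi> Y)))
    + 2 * norm A * (\<Sum>Z\<in>\<N>. integral {0..t} (leak W (\<phi> Z)))"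
proof -
  let ?K = "generator W" and ?L = "\<Sum>Z\<in>Pow W - \<N>. \<phi> Z"
  let ?c = "\<lambda>Z Y s. norm (comm (flow ?K s (\<phi> Z)) (\<phi> Y))"
  have KL: "?K - ?L = (\<Sum>Z\<in>\<N>. \<phi> Z)"
    unfolding generator_def using assms(1) by (subst sum_diff) auto
  have Y: "norm (comm (flow ?K t A) (\<phi> Y)) \<le> norm (comm (flow ?L t A) (\<phi> Y))
      + 2 * norm A * (\<Sum>Z\<in>\<N>. integral {0..t} (?c Z Y))" for Y
  proof -
    \<comment> \<open>The vanishing integrals over \<open>{0..0}\<close> are the initial value of
      the primitive expected by \<open>norm_comm_flow_le\<close>.\<close>
    have "norm (comm (flow ?K t A) (\<phi> Y)) \<le> norm (comm (flow ?L t A) (\<phi> Y))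
      + 2 * norm A * ((\<Sum>Z\<in>\<N>. integral {0..t} (?c Z Y)) - (\<Sum>Z\<in>\<N>. integral {0..0} (?c Z Y)))"
    proof (rule norm_comm_flow_le[OF contractive_generator contractive_sum assms(2)])
      fix s assume s: "0 \<le> s" "s \<le> t"
      show "norm (comm (flow ?K s (?K - ?L)) (\<phi> Y)) \<le> (\<Sum>Z\<in>\<N>. ?c Z Y s)"
        unfolding KL flow_sum comm_sum_left by (rule norm_sum)
      show "((\<lambda>s. \<Sum>Z\<in>\<N>. integral {0..s} (?c Z Y)) has_vector_derivative (\<Sum>Z\<in>\<N>. ?c Z Y s))
          (at s within {0..t})"
        using s by (intro has_vector_derivative_sum integral_has_vector_derivative continuous_on_comm_flow) auto
    qed
    then show ?thesis by simp
  qed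
  have "leak W A t \<le> (\<Sum>Y | \<not> Y \<subseteq> W. norm (comm (flow ?L t A) (\<phi> Y))
      + 2 * norm A * (\<Sum>Z\<in>\<N>. integral {0..t} (?c Z Y)))"
    unfolding leak_def by (intro sum_mono Y)
  also have "\<dots> = (\<Sum>Y | \<not> Y \<subseteq> W. norm (comm (flow ?L t A) (\<phi> Y)))
      + 2 * norm A * (\<Sum>Y | \<not> Y \<subseteq> W. \<Sum>Z\<in>\<N>. integral {0..t} (?c Z Y))"
    by (simp add: sum.distrib sum_distrib_left)
  also have "(\<Sum>Y | \<not> Y \<subseteq> W. \<Sum>Z\<in>\<N>. integral {0..t} (?c Z Y))
      = (\<Sum>Z\<in>\<N>. \<Sum>Y | \<not> Y \<subseteq> W. integral {0..t} (?c Z Y))"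
    by (rule sum.swap)
  also have "\<dots> = (\<Sum>Z\<in>\<N>. integral {0..t} (leak W (\<phi> Z)))"
    unfolding leak_def
    by (intro sum.cong refl integral_sum[symmetric] integrable_continuous_interval continuous_on_comm_flow) auto
  finally show ?thesis .
qed

text \<open>The leakages of all interaction terms are bounded simultaneously by
  \<open>gronwall_system\<close>. In the rate \<open>2 * g\<close> the 2 comes from the commutator
  bound and \<open>g\<close> from \<open>sum_norm_tail_le\<close>.\<close>

lemma leak_interaction_le:
  assumes "0 \<le> t"
  shows "leak W (\<phi> Z) t \<le> 2 * norm (\<phi> Z) * (g * (\<Sum>z\<in>Z. tail W z)) * exp (2 * g * t)"
proof -
  define q where "q Z = 2 * norm (\<phi> Z) * (g * (\<Sum>z\<in>Z. tail W z))" for Z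
  define b where "b Z Z' = (if Z' \<subseteq> W \<and> Z' \<inter> Z \<noteq> {} then 2 * norm (\<phi> Z) else 0)" for Z Z'
  \<comment> \<open>A crude bound from the trivial commutator estimate; it only has to be uniform in
    \<open>Z\<close> and in time.\<close>
  define M where "M = (\<Sum>Z\<in>UNIV. \<Sum>Y\<in>UNIV. 2 * norm (\<phi> Z) * norm (\<phi> Y))"
  have "leak W (\<phi> Z) t \<le> q Z * exp (2 * g * t)"
  proof (rule gronwall_system[where I = UNIV and u = "\<lambda>Z. leak W (\<phi> Z)" and M = M and b = b
        and B = "\<Sum>Z\<in>UNIV. \<Sum>Z'\<in>UNIV. b Z Z'"])
    show "leak W (\<phi> Z) t \<le> M" for Z t
    proof -
      have "leak W (\<phi> Z) t \<le> (\<Sum>Y | \<not> Y \<subseteq> W. 2 * norm (\<phi> Z) * norm (\<phi> Y))"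
        unfolding leak_def
        using norm_comm_le[of "flow (generator W) t (\<phi> Z)"]
        by (intro sum_mono) (simp add: norm_flow contractive_generator)
      also have "\<dots> \<le> (\<Sum>Y\<in>UNIV. 2 * norm (\<phi> Z) * norm (\<phi> Y))" by (intro sum_mono2) auto
      also have "\<dots> \<le> M" unfolding M_def by (rule member_le_sum) (auto intro: sum_nonneg)
      finally show ?thesis .
    qed
    show "0 \<le> M" unfolding M_def by (intro sum_nonneg) simp
    show "0 \<le> b Z Z'" for Z Z' by (simp add: b_def)
    show "(\<Sum>Z'\<in>UNIV. b Z Z') \<le> (\<Sum>Z\<in>UNIV. \<Sum>Z'\<in>UNIV. b Z Z')" for Z
      by (rule member_le_sum) (auto intro: sum_nonneg simp: b_def)
    show "0 \<le> q Z" for Z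
      unfolding q_def using g_pos by (intro mult_nonneg_nonneg sum_nonneg tail_nonneg) auto
    show "0 < 2 * g" using g_pos by simp
    show "(\<Sum>Z'\<in>UNIV. b Z Z' * q Z') \<le> 2 * g * q Z" for Z
    proof -
      have "(\<Sum>Z'\<in>UNIV. b Z Z' * q Z')
          = (\<Sum>Z' | Z' \<subseteq> W \<and> Z' \<inter> Z \<noteq> {}. 2 * norm (\<phi> Z) * q Z')"
        unfolding b_def if_distrib[of "\<lambda>r. r * _"] mult_zero_left
        by (subst sum.inter_filter[symmetric]) auto
      also have "\<dots> = 4 * g * norm (\<phi> Z) * (\<Sum>Z' | Z' \<subseteq> W \<and> Z' \<inter> Z \<noteq> {}. norm (\<phi> Z') * (\<Sum>z\<in>Z'. tail W z))"
        by (simp add: q_def sum_distrib_left mult_ac)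
      also have "(\<Sum>Z' | Z' \<subseteq> W \<and> Z' \<inter> Z \<noteq> {}. norm (\<phi> Z') * (\<Sum>z\<in>Z'. tail W z))
          \<le> (\<Sum>z\<in>Z. \<Sum>Z'\<in>{Z'\<in>{Z'. Z' \<subseteq> W \<and> Z' \<inter> Z \<noteq> {}}. z \<in> Z'}. norm (\<phi> Z') * (\<Sum>z\<in>Z'. tail W z))"
        by (rule sum_le_sum_meeting) (auto simp: norm_mult_tail_nonneg)
      also have "\<dots> \<le> (\<Sum>z\<in>Z. \<Sum>Z' | z \<in> Z'. norm (\<phi> Z') * (\<Sum>z\<in>Z'. tail W z))"
        by (intro sum_mono sum_mono2) (auto simp: norm_mult_tail_nonneg)
      also have "\<dots> \<le> (\<Sum>z\<in>Z. g * tail W z)"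
        by (intro sum_mono sum_norm_tail_le)
      also have "4 * g * norm (\<phi> Z) * \<dots> = 2 * g * q Z"
        by (simp add: q_def sum_distrib_left mult_ac)
      finally show ?thesis using g_pos by (simp add: mult_left_mono)
    qed
    show "leak W (\<phi> Z) t \<le> q Z + (\<Sum>Z'\<in>UNIV. b Z Z' * integral {0..t} (leak W (\<phi> Z')))"
      if "0 \<le> t" for Z t
    proof -
      let ?N = "{Z'. Z' \<subseteq> W \<and> Z' \<inter> Z \<noteq> {}}"
      \<comment> \<open>What is left of the generator is disjoint from \<open>Z\<close>, so its flow
        fixes \<open>\<phi> Z\<close> and only the commutators at time zero remain.\<close>
      have "(\<Sum>Z'\<in>Pow W - ?N. \<phi> Z') * \<phi> Z = \<phi> Z * (\<Sum>Z'\<in>Pow W - ?N. \<phi> Z')"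
        unfolding sum_distrib_left sum_distrib_right
        by (intro sum.cong refl disjoint_commute) auto
      then have fl: "flow (\<Sum>Z'\<in>Pow W - ?N. \<phi> Z') t (\<phi> Z) = \<phi> Z"
        by (rule flow_cong_commute)
      have "(\<Sum>Y | \<not> Y \<subseteq> W. norm (comm (\<phi> Z) (\<phi> Y)))
          \<le> (\<Sum>Y | \<not> Y \<subseteq> W. if Y \<inter> Z \<noteq> {} then 2 * norm (\<phi> Z) * norm (\<phi> Y) else 0)"
        using norm_comm_le[of "\<phi> Z"] disjoint_commute[of _ Z]
        by (intro sum_mono) (auto simp: comm_def)
      also have "\<dots> = 2 * norm (\<phi> Z) * (\<Sum>Y | \<not> Y \<subseteq> W \<and> Y \<inter> Z \<noteq> {}. norm (\<phi> Y))"
        by (simp add: sum_distrib_left flip: sum.inter_filter)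
      also have "(\<Sum>Y | \<not> Y \<subseteq> W \<and> Y \<inter> Z \<noteq> {}. norm (\<phi> Y))
          \<le> (\<Sum>z\<in>Z. \<Sum>Y\<in>{Y\<in>{Y. \<not> Y \<subseteq> W \<and> Y \<inter> Z \<noteq> {}}. z \<in> Y}. norm (\<phi> Y))"
        by (rule sum_le_sum_meeting) auto
      also have "\<dots> \<le> (\<Sum>z\<in>Z. \<Sum>Y | \<not> Y \<subseteq> W \<and> z \<in> Y. norm (\<phi> Y))"
        by (intro sum_mono sum_mono2) auto
      also have "\<dots> \<le> (\<Sum>z\<in>Z. g * tail W z)"
        by (intro sum_mono sum_norm_outside_le)
      also have "2 * norm (\<phi> Z) * \<dots> = q Z" by (simp add: q_def sum_distrib_left)
      finally have init: "(\<Sum>Y | \<not> Y \<subseteq> W. norm (comm (\<phi> Z) (\<phi> Y))) \<le> q Z"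
        by (simp add: mult_left_mono)
      have "(\<Sum>Z'\<in>UNIV. b Z Z' * integral {0..t} (leak W (\<phi> Z')))
          = 2 * norm (\<phi> Z) * (\<Sum>Z'\<in>?N. integral {0..t} (leak W (\<phi> Z')))"
        unfolding b_def if_distrib[of "\<lambda>r. r * _"] mult_zero_left
        by (subst sum.inter_filter[symmetric]) (auto simp: sum_distrib_left)
      moreover have "leak W (\<phi> Z) t \<le> (\<Sum>Y | \<not> Y \<subseteq> W. norm (comm (\<phi> Z) (\<phi> Y)))
          + 2 * norm (\<phi> Z) * (\<Sum>Z'\<in>?N. integral {0..t} (leak W (\<phi> Z')))"
        using leak_le[of ?N W t "\<phi> Z"] that unfolding fl by auto
      ultimately show ?thesis using init by linarith
    qed
  qed (use assms continuous_on_leak in auto)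
  then show ?thesis by (simp add: q_def)
qed

text \<open>The time derivative only sees the interaction terms in \<open>?N\<close> that straddle the boundary: the terms
  inside \<open>X\<close> rotate \<open>A\<close> without destroying its commutation with everything disjoint from \<open>X\<close>.\<close>

lemma leak_observable_le:
  assumes X: "X \<subseteq> W" and A: "\<And>Y. Y \<inter> X = {} \<Longrightarrow> A * \<phi> Y = \<phi> Y * A" and t: "0 \<le> t"
  shows "leak W A t \<le> 2 * norm A * g * (\<Sum>x\<in>boundary X. tail W x) * exp (2 * g * t)"
proof -
  let ?S = "\<Sum>x\<in>boundary X. tail W x"
  \<comment> \<open>Restricting to nonzero terms matches the definition of \<open>boundary\<close>:
    a nonzero straddling term meets \<open>X\<close> in a boundary site.\<close>
  let ?N = "{Z. Z \<subseteq> W \<and> Z \<inter> X \<noteq> {} \<and> \<not> Z \<subseteq> X \<and> \<phi> Z \<noteq> 0}"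
  let ?L = "\<Sum>Z\<in>Pow W - ?N. \<phi> Z"
  \<comment> \<open>Each term of \<open>?Lout\<close> is zero or disjoint from \<open>X\<close>,
    hence commutes with \<open>A\<close> and with \<open>?Lin\<close>.\<close>
  let ?Lin = "\<Sum>Z\<in>Pow X. \<phi> Z" and ?Lout = "\<Sum>Z\<in>Pow W - ?N - Pow X. \<phi> Z"
  have commute: "\<phi> Z * A = A * \<phi> Z" if "Z \<in> Pow W - ?N - Pow X" for Z
    using that A[of Z] by (cases "\<phi> Z = 0") auto
  have Lout: "?Lout * A = A * ?Lout"
    unfolding sum_distrib_left sum_distrib_right by (intro sum.cong refl commute)
  have Lin: "?Lin * \<phi> Y = \<phi> Y * ?Lin" if "Y \<inter> X = {} \<or> \<phi> Y = 0" for Y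
    unfolding sum_distrib_left sum_distrib_right
  proof (intro sum.cong refl)
    fix Z assume "Z \<in> Pow X"
    then show "\<phi> Z * \<phi> Y = \<phi> Y * \<phi> Z"
      using that disjoint_commute[of Z Y] by (cases "\<phi> Y = 0") auto
  qed
  have "?L = ?Lin + ?Lout"
    using X by (subst sum.subset_diff[of "Pow X" "Pow W - ?N"]) auto
  moreover have "?Lin * ?Lout = ?Lout * ?Lin"
    unfolding sum_distrib_left[of ?Lin] sum_distrib_right[of _ _ ?Lin]
    by (intro sum.cong refl Lin) auto
  ultimately have fl: "flow ?L t A = flow ?Lin t A"
    by (simp only: flow_add flow_cong_commute[OF Lout])
  have zero: "comm (flow ?L t A) (\<phi> Y) = 0" if Y: "Y \<inter> X = {} \<or> \<phi> Y = 0" for Y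
  proof -
    have "comm (flow ?L t A) (\<phi> Y) = flow ?Lin t (comm A (\<phi> Y))"
      unfolding fl flow_comm flow_cong_commute[OF Lin[OF Y]] ..
    also have "comm A (\<phi> Y) = 0" using Y A[of Y] by (auto simp: comm_def)
    finally show ?thesis by (simp add: flow_def)
  qed
  have meets: "Z \<inter> boundary X \<noteq> {}" if "Z \<inter> X \<noteq> {}" "\<not> Z \<subseteq> X" "\<phi> Z \<noteq> 0" for Z
    using that unfolding boundary_def by blast
  have "(\<Sum>Y | \<not> Y \<subseteq> W. norm (comm (flow ?L t A) (\<phi> Y)))
      \<le> (\<Sum>Y | \<not> Y \<subseteq> W. if Y \<inter> X \<noteq> {} \<and> \<phi> Y \<noteq> 0 then 2 * norm A * norm (\<phi> Y) else 0)"
    using norm_comm_le[of "flow ?L t A"] zero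
    by (intro sum_mono) (auto simp: norm_flow contractive_sum)
  also have "\<dots> = 2 * norm A * (\<Sum>Y | \<not> Y \<subseteq> W \<and> Y \<inter> X \<noteq> {} \<and> \<phi> Y \<noteq> 0. norm (\<phi> Y))"
    by (simp add: sum_distrib_left flip: sum.inter_filter)
  also have "(\<Sum>Y | \<not> Y \<subseteq> W \<and> Y \<inter> X \<noteq> {} \<and> \<phi> Y \<noteq> 0. norm (\<phi> Y))
      \<le> (\<Sum>x\<in>boundary X. \<Sum>Y\<in>{Y\<in>{Y. \<not> Y \<subseteq> W \<and> Y \<inter> X \<noteq> {} \<and> \<phi> Y \<noteq> 0}. x \<in> Y}. norm (\<phi> Y))"
    using X by (intro sum_le_sum_meeting meets) auto
  also have "\<dots> \<le> (\<Sum>x\<in>boundary X. \<Sum>Y | \<not> Y \<subseteq> W \<and> x \<in> Y. norm (\<phi> Y))"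
    by (intro sum_mono sum_mono2) auto
  also have "\<dots> \<le> (\<Sum>x\<in>boundary X. g * tail W x)" by (intro sum_mono sum_norm_outside_le)
  also have "\<dots> = g * ?S" by (simp add: sum_distrib_left)
  finally have init: "(\<Sum>Y | \<not> Y \<subseteq> W. norm (comm (flow ?L t A) (\<phi> Y))) \<le> 2 * norm A * (g * ?S)"
    by (simp add: mult_left_mono)

  let ?e = "(exp (2 * g * t) - 1) / (2 * g)"
  have e: "0 \<le> ?e" using g_pos t by simp
  have "integral {0..t} (leak W (\<phi> Z)) \<le> 2 * norm (\<phi> Z) * (g * (\<Sum>z\<in>Z. tail W z)) * ?e" for Z
  proof (rule has_integral_le)
    show "(leak W (\<phi> Z) has_integral integral {0..t} (leak W (\<phi> Z))) {0..t}"
      by (intro integrable_integral integrable_continuous_interval continuous_on_leak)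
    show "((\<lambda>t. 2 * norm (\<phi> Z) * (g * (\<Sum>z\<in>Z. tail W z)) * exp (2 * g * t)) has_integral
        2 * norm (\<phi> Z) * (g * (\<Sum>z\<in>Z. tail W z)) * ?e) {0..t}"
      using g_pos t by (intro has_integral_mult_right exp_has_integral) auto
  qed (use leak_interaction_le in auto)
  then have "(\<Sum>Z\<in>?N. integral {0..t} (leak W (\<phi> Z)))
      \<le> (\<Sum>Z\<in>?N. 2 * norm (\<phi> Z) * (g * (\<Sum>z\<in>Z. tail W z)) * ?e)"
    by (rule sum_mono)
  also have "\<dots> = 2 * g * ?e * (\<Sum>Z\<in>?N. norm (\<phi> Z) * (\<Sum>z\<in>Z. tail W z))"
    unfolding sum_distrib_left[of "2 * g * ?e"] by (intro sum.cong refl) (simp only: mult_ac)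
  also have "(\<Sum>Z\<in>?N. norm (\<phi> Z) * (\<Sum>z\<in>Z. tail W z))
      \<le> (\<Sum>x\<in>boundary X. \<Sum>Z\<in>{Z\<in>?N. x \<in> Z}. norm (\<phi> Z) * (\<Sum>z\<in>Z. tail W z))"
    by (intro sum_le_sum_meeting meets) (auto simp: norm_mult_tail_nonneg)
  also have "\<dots> \<le> (\<Sum>x\<in>boundary X. \<Sum>Z | x \<in> Z. norm (\<phi> Z) * (\<Sum>z\<in>Z. tail W z))"
    by (intro sum_mono sum_mono2) (auto simp: norm_mult_tail_nonneg)
  also have "\<dots> \<le> (\<Sum>x\<in>boundary X. g * tail W x)" by (intro sum_mono sum_norm_tail_le)
  also have "\<dots> = g * ?S" by (simp add: sum_distrib_left)
  also have "2 * g * ?e = exp (2 * g * t) - 1" using g_pos by simp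
  finally have "(\<Sum>Z\<in>?N. integral {0..t} (leak W (\<phi> Z))) \<le> (exp (2 * g * t) - 1) * (g * ?S)"
    using g_pos t by (simp add: mult_left_mono)
  then have "2 * norm A * (\<Sum>Z\<in>?N. integral {0..t} (leak W (\<phi> Z)))
      \<le> 2 * norm A * ((exp (2 * g * t) - 1) * (g * ?S))"
    by (intro mult_left_mono) auto
  moreover have "leak W A t \<le> (\<Sum>Y | \<not> Y \<subseteq> W. norm (comm (flow ?L t A) (\<phi> Y)))
      + 2 * norm A * (\<Sum>Z\<in>?N. integral {0..t} (leak W (\<phi> Z)))"
    by (rule leak_le[OF _ t]) auto
  \<comment> \<open>The constant part supplies the 1 missing from
    \<open>exp (2 * g * t) - 1\<close>, and the sum is the full exponential.\<close>
  ultimately have "leak W A t \<le> 2 * norm A * (g * ?S) + 2 * norm A * ((exp (2 * g * t) - 1) * (g * ?S))"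
    using init by linarith
  then show ?thesis by (simp add: algebra_simps)
qed

text \<open>Duhamel's formula reduces the error to the leakage of \<open>A\<close>. The factor
  \<open>2 * g\<close> in \<open>leak_observable_le\<close> is absorbed when the exponential is
  integrated, which leaves the constant 1.\<close>

theorem truncation_error_le:
  assumes X: "X \<subseteq> W" and A: "\<And>Y. Y \<inter> X = {} \<Longrightarrow> A * \<phi> Y = \<phi> Y * A" and t: "0 \<le> t"
  shows "norm (flow (generator UNIV) t A - flow (generator W) t A)
    \<le> norm A * (\<Sum>x\<in>boundary X. tail W x) * (exp (2 * g * t) - 1)"
proof -
  let ?S = "\<Sum>x\<in>boundary X. tail W x"
  have diff: "generator UNIV - generator W = (\<Sum>Y | \<not> Y \<subseteq> W. \<phi> Y)"
    unfolding generator_def by (subst sum_diff[symmetric]) (auto intro!: sum.cong)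
  have "norm (flow (generator UNIV) t A - flow (generator W) t A)
    \<le> norm A * ?S * exp (2 * g * t) - norm A * ?S * exp (2 * g * 0)"
  proof (rule norm_flow_diff_le[OF contractive_generator contractive_generator t])
    fix s assume s: "0 \<le> s" "s \<le> t"
    have "norm (comm (generator UNIV - generator W) (flow (generator W) s A)) \<le> leak W A s"
      unfolding diff comm_sum_left leak_def
      by (rule order_trans[OF norm_sum])
        (subst comm_swap, simp)
    with leak_observable_le[OF X A s(1)]
    show "norm (comm (generator UNIV - generator W) (flow (generator W) s A))
        \<le> 2 * norm A * g * ?S * exp (2 * g * s)" by simp
    show "((\<lambda>s. norm A * ?S * exp (2 * g * s)) has_vector_derivative 2 * norm A * g * ?S * exp (2 * g * s))
        (at s within {0..t})"
      unfolding has_real_derivative_iff_has_vector_derivative[symmetric]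
      by (auto intro!: derivative_eq_intros)
  qed
  then show ?thesis by (simp add: algebra_simps)
qed

end

section \<open>Heisenberg dynamics of fermions\<close>

lemma cscale_mult_vec: "cscale c A *v v = (\<chi> i. c * (A *v v) $ i)"
  for A :: "complex ^ 'n ^ 'm"
  by (simp add: cscale_def matrix_vector_mult_def vec_eq_iff sum_distrib_left mult.assoc)

lemma op_norm_cscale_ii: "op_norm (cscale \<i> A) = op_norm A"
  for A :: "complex ^ 'n ^ 'm"
  by (simp add: op_norm_def onorm_def cscale_mult_vec norm_vec_def norm_mult)

lemma cscale_sum: "cscale c (\<Sum>i\<in>I. A i) = (\<Sum>i\<in>I. cscale c (A i))"
  for A :: "'i \<Rightarrow> complex ^ 'n ^ 'm"
  by (simp add: cscale_def vec_eq_iff sum_distrib_left)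

lemma op_of_sum: "op_of (\<Sum>i\<in>I. A i) = (\<Sum>i\<in>I. op_of (A i))"
  by (rule linear_sum[OF bounded_linear.linear[OF bounded_linear_op_of]])

lemma dagger_sum: "dagger (\<Sum>i\<in>I. A i) = (\<Sum>i\<in>I. dagger (A i))"
  for A :: "'i \<Rightarrow> complex ^ 'n ^ 'm"
  by (simp add: dagger_def vec_eq_iff)

text \<open>The real inner product is the real part of the Hermitian one, and the expectation
  \<open>X\<close> of a self-adjoint matrix is real, so \<open>\<i> * X\<close> has no real
  part.\<close>

lemma inner_cscale_ii_self_adjoint:
  fixes H :: "complex ^ 'n ^ 'n"
  assumes "self_adjoint H"
  shows "w \<bullet> (cscale \<i> H *v w) = 0"
proof -
  define X where "X = (\<Sum>i\<in>UNIV. \<Sum>j\<in>UNIV. cnj (w $ i) * H $ i $ j * w $ j)"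
  have H: "cnj (H $ i $ j) = H $ j $ i" for i j
    using assms by (auto simp: self_adjoint_def dagger_def vec_eq_iff)
  have "cnj X = (\<Sum>i\<in>UNIV. \<Sum>j\<in>UNIV. cnj (w $ j) * H $ j $ i * w $ i)"
    by (simp add: X_def H mult_ac)
  also have "\<dots> = X" unfolding X_def by (rule sum.swap)
  finally have "Im X = 0" by (simp add: complex_eq_iff)
  have "w \<bullet> (cscale \<i> H *v w) = (\<Sum>i\<in>UNIV. Re (cnj (w $ i) * (\<i> * (H *v w) $ i)))"
    unfolding inner_vec_def cscale_mult_vec
    by (intro sum.cong refl) (simp add: inner_complex_def)
  also have "\<dots> = Re (\<i> * X)"
    by (simp only: X_def matrix_vector_mult_def vec_lambda_beta sum_distrib_left Re_sum mult_ac)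
  finally show ?thesis using \<open>Im X = 0\<close> by simp
qed

text \<open>Along an orbit of the exponential the squared norm has derivative zero by
  \<open>inner_cscale_ii_self_adjoint\<close>, so the exponential preserves the norm of every
  vector.\<close>

lemma contractive_self_adjoint:
  fixes H :: "complex ^ 'n::finite ^ 'n"
  assumes "self_adjoint H"
  shows "contractive (op_of (cscale \<i> H))"
  unfolding contractive_def
proof
  fix t :: real
  define K where "K = op_of (cscale \<i> H)"
  have "norm (mat_of (exp (t *\<^sub>R K)) *v v) = norm v" for v
  proof -
    define f where "f s = mat_of (exp (s *\<^sub>R K)) *v v" for s
    have "bounded_linear (\<lambda>A :: 'n opalg. mat_of A *v v)"
      by (rule bounded_linear_intro[where K = "norm v"]; transfer)
        (auto simp: matrix_vector_mult_add_rdistrib scaleR_matrix_vector_mult norm_matrix_vector_le_op_norm)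
    from bounded_linear.has_vector_derivative[OF this exp_scaleR_has_vector_derivative_left]
    have "(f has_vector_derivative mat_of (K * exp (s *\<^sub>R K)) *v v) (at s)" for s
      unfolding f_def .
    then have f': "(f has_vector_derivative cscale \<i> H *v f s) (at s)" for s
      by (simp add: f_def times_opalg.rep_eq K_def op_of_inverse matrix_vector_mul_assoc)
    have "((\<lambda>s. f s \<bullet> f s) has_vector_derivative
        f s \<bullet> (cscale \<i> H *v f s) + (cscale \<i> H *v f s) \<bullet> f s) (at s)" for s
      by (rule bounded_bilinear.has_vector_derivative[OF bounded_bilinear_inner f' f'])
    then have "((\<lambda>s. f s \<bullet> f s) has_real_derivative 0) (at s)" for s
      unfolding has_real_derivative_iff_has_vector_derivative
      by (simp only: inner_commute[of "cscale \<i> H *v f s" for s] inner_cscale_ii_self_adjoint[OF assms] add_0)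
    then have "f t \<bullet> f t = f 0 \<bullet> f 0" by (intro DERIV_isconst_all) auto
    then show ?thesis
      by (simp add: f_def one_opalg.rep_eq norm_eq_sqrt_inner)
  qed
  then show "norm (exp (t *\<^sub>R op_of (cscale \<i> H))) \<le> 1"
    unfolding norm_opalg.rep_eq op_norm_def K_def by (intro onorm_le) simp
qed

text \<open>Since \<open>opalg\<close> is a real algebra, the imaginary unit is absorbed into the
  generator and time remains a real scalar.\<close>

lemma heisenberg_eq_flow:
  "heisenberg H A t = mat_of (flow (op_of (cscale \<i> H)) t (op_of A))"
  for H :: "complex ^ 'n::finite ^ 'n"
proof -
  have "cscale (\<i> * of_real t) H = t *\<^sub>R cscale \<i> H" "cscale (- \<i> * of_real t) H = - t *\<^sub>R cscale \<i> H"
    by (simp_all add: cscale_def vec_eq_iff scaleR_conv_of_real[where 'a = complex])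
  then show ?thesis
    unfolding heisenberg_def flow_def mexp_eq
    by (simp only: times_opalg.rep_eq scaleR_opalg.abs_eq op_of_inverse[OF UNIV_I])
qed

section \<open>Expectation values and dense outputs\<close>

lemma cmod_expect_le: "cmod (expect \<psi> A) \<le> op_norm A * (norm \<psi>)\<^sup>2"
proof -
  have "cmod (expect \<psi> A) \<le> (\<Sum>i\<in>UNIV. \<bar>norm (\<psi> $ i)\<bar> * \<bar>norm ((A *v \<psi>) $ i)\<bar>)"
    unfolding expect_def by (rule order_trans[OF norm_sum]) (simp add: norm_mult)
  also have "\<dots> \<le> norm \<psi> * norm (A *v \<psi>)"
    unfolding norm_vec_def by (rule L2_set_mult_ineq)
  also have "\<dots> \<le> norm \<psi> * (op_norm A * norm \<psi>)"
    by (intro mult_left_mono norm_matrix_vector_le_op_norm norm_ge_zero)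
  finally show ?thesis by (simp add: power2_eq_square mult_ac)
qed

lemma expect_diff: "expect \<psi> (A - B) = expect \<psi> A - expect \<psi> B"
  by (simp add: expect_def matrix_vector_mult_diff_rdistrib sum_subtractf algebra_simps)

lemma bounded_linear_expect: "bounded_linear (\<lambda>A :: 'n::finite opalg. expect \<psi> (mat_of A))"
proof (rule bounded_linear_intro[where K = "(norm \<psi>)\<^sup>2"])
  fix A B :: "'n opalg" and r :: real
  show "expect \<psi> (mat_of (A + B)) = expect \<psi> (mat_of A) + expect \<psi> (mat_of B)"
    by (simp add: plus_opalg.rep_eq expect_def matrix_vector_mult_add_rdistrib sum.distrib distrib_left)
  show "expect \<psi> (mat_of (r *\<^sub>R A)) = r *\<^sub>R expect \<psi> (mat_of A)"
    by (simp add: scaleR_opalg.rep_eq expect_def scaleR_matrix_vector_mult scaleR_sum_right)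
  show "norm (expect \<psi> (mat_of A)) \<le> norm A * (norm \<psi>)\<^sup>2"
    by (simp add: norm_opalg.rep_eq cmod_expect_le)
qed

lemma continuous_on_expect_heisenberg: "continuous_on S (\<lambda>t. expect \<psi> (heisenberg H A t))"
  unfolding heisenberg_eq_flow
  by (intro bounded_linear.continuous_on[OF bounded_linear_expect] continuous_on_flow)

lemma op_norm_heisenberg_diff:
  "op_norm (heisenberg H A t - heisenberg H' A t) =
    norm (flow (op_of (cscale \<i> H)) t (op_of A) - flow (op_of (cscale \<i> H')) t (op_of A))"
  by (simp add: heisenberg_eq_flow norm_opalg.rep_eq minus_opalg.rep_eq)

lemma continuous_on_op_norm_heisenberg_diff:
  "continuous_on S (\<lambda>t. op_norm (heisenberg H A t - heisenberg H' A t))"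
  unfolding op_norm_heisenberg_diff by (intro continuous_intros)

lemma dense_output_diff_le:
  assumes "norm \<psi> = 1"
  shows "cmod (dense_output H A \<psi> T - dense_output H' A \<psi> T)
    \<le> integral {0..T} (\<lambda>t. op_norm (heisenberg H A t - heisenberg H' A t))"
proof -
  have "dense_output H A \<psi> T - dense_output H' A \<psi> T
      = integral {0..T} (\<lambda>t. expect \<psi> (heisenberg H A t) - expect \<psi> (heisenberg H' A t))"
    unfolding dense_output_def
    by (intro integral_diff[symmetric] integrable_continuous_interval continuous_on_expect_heisenberg)
  also have "cmod \<dots> \<le> integral {0..T} (\<lambda>t. op_norm (heisenberg H A t - heisenberg H' A t))"
  proof (rule integral_norm_bound_integral)
    fix t
    show "cmod (expect \<psi> (heisenberg H A t) - expect \<psi> (heisenberg H' A t))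
        \<le> op_norm (heisenberg H A t - heisenberg H' A t)"
      using cmod_expect_le[of \<psi> "heisenberg H A t - heisenberg H' A t"] assms
      by (simp add: expect_diff)
  qed (intro integrable_continuous_interval continuous_intros continuous_on_expect_heisenberg
      continuous_on_op_norm_heisenberg_diff)+
  finally show ?thesis .
qed

section \<open>The kernel of an \<open>F\<close>-function and its tail sums\<close>

lemma F_function_pos:
  assumes "Metric_space UNIV d" "F_function d F"
  shows "0 < F (d x y)"
  using assms(2) Metric_space.nonneg[OF assms(1)] by (simp add: F_function_def)

lemma conv_ratio_le_conv_const:
  assumes "F_function d F"
  shows "conv_ratio d F x y \<le> conv_const d F"
proof -
  have "bdd_above (range (\<lambda>(x, y). conv_ratio d F x y))" using assms by (simp add: F_function_def)
  from cSUP_upper[OF UNIV_I this, of "(x, y)"] show ?thesis by (simp add: conv_const_def)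
qed

lemma conv_const_pos:
  assumes "Metric_space UNIV d" "F_function d F"
  shows "0 < conv_const d F"
proof -
  fix x
  have "0 < conv_ratio d F x x"
    unfolding conv_ratio_def by (intro sum_pos divide_pos_pos mult_pos_pos F_function_pos assms) auto
  then show ?thesis using conv_ratio_le_conv_const[OF assms(2)] by (rule less_le_trans)
qed

lemma G_kernel_nonneg:
  assumes "Metric_space UNIV d" "F_function d F"
  shows "0 \<le> G_kernel d F x y"
  using conv_const_pos[OF assms] F_function_pos[OF assms, of x y] by (simp add: G_kernel_def)

text \<open>One of the two factors \<open>inverse ?C\<close> is spent on the convolution bound; the
  other normalizes the kernel on the right.\<close>

lemma G_kernel_convolution:
  assumes "Metric_space UNIV d" "F_function d F"
  shows "(\<Sum>z\<in>UNIV. G_kernel d F x z * G_kernel d F z y) \<le> G_kernel d F x y"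
proof -
  let ?C = "conv_const d F"
  have C: "0 < ?C" and Fxy: "0 < F (d x y)"
    using assms by (auto intro: conv_const_pos F_function_pos)
  have "(\<Sum>z\<in>UNIV. G_kernel d F x z * G_kernel d F z y)
      = inverse ?C * inverse ?C * F (d x y) * conv_ratio d F x y"
    using Fxy by (simp add: G_kernel_def conv_ratio_def sum_distrib_left field_simps)
  also have "\<dots> \<le> inverse ?C * inverse ?C * F (d x y) * ?C"
    using C Fxy by (intro mult_left_mono conv_ratio_le_conv_const assms) auto
  also have "\<dots> = G_kernel d F x y" using C by (simp add: G_kernel_def)
  finally show ?thesis .
qed

lemma subset_fattening:
  assumes "Metric_space UNIV d" "0 \<le> R"
  shows "X \<subseteq> fattening d X R"
proof
  fix x :: 'a assume "x \<in> X"
  have "bdd_below (d x ` X)"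
    using Metric_space.nonneg[OF assms(1)] by (auto intro!: bdd_belowI[where m = 0])
  from cINF_lower[OF this \<open>x \<in> X\<close>] show "x \<in> fattening d X R"
    using assms(2) Metric_space.mdist_zero[OF assms(1), of x] by (simp add: fattening_def dist_set_def)
qed

lemma tail_sum_nonneg:
  assumes "Metric_space UNIV d" "F_function d F"
  shows "0 \<le> tail_sum d F \<Phi> X R"
  unfolding tail_sum_def by (intro sum_nonneg G_kernel_nonneg assms)

lemma antimono_tail_sum:
  assumes "Metric_space UNIV d" "F_function d F"
  shows "antimono_on S (tail_sum d F \<Phi> X)"
proof (rule monotone_onI)
  fix r s :: real assume "r \<le> s"
  then have "UNIV - fattening d X s \<subseteq> UNIV - fattening d X r" by (auto simp: fattening_def)
  then show "tail_sum d F \<Phi> X s \<le> tail_sum d F \<Phi> X r"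
    unfolding tail_sum_def by (intro sum_mono sum_mono2 G_kernel_nonneg assms) auto
qed

text \<open>The lattice is finite, so the tail vanishes once \<open>R\<close> exceeds all distances to \<open>X\<close>.\<close>

lemma tail_sum_tendsto_0: "(tail_sum d F \<Phi> X \<longlongrightarrow> 0) at_top"
proof (rule tendsto_eventually)
  have "\<forall>\<^sub>F R in at_top. \<forall>x\<in>UNIV. dist_set d x X \<le> R"
    by (intro eventually_ball_finite ballI eventually_ge_at_top) simp
  then show "\<forall>\<^sub>F R in at_top. tail_sum d F \<Phi> X R = 0"
    by (rule eventually_mono) (simp add: tail_sum_def fattening_def)
qed

text \<open>The locale is instantiated with \<open>\<i> * \<Phi>(Z)\<close> in \<open>opalg\<close>.
  Partial sums of self-adjoint terms are self-adjoint, which gives contractivity, and evenness gives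
  commutation at disjoint sites.\<close>

lemma heisenberg_truncation_le:
  fixes d :: "'a::{finite,linorder} \<Rightarrow> 'a \<Rightarrow> real"
  assumes d: "Metric_space UNIV d"
    and \<Phi>: "fermionic_interaction \<Phi>"
    and F: "F_function d F"
    and g: "0 < g"
    and decay: "\<And>x y. (\<Sum>Z | x \<in> Z \<and> y \<in> Z. op_norm (\<Phi> Z)) \<le> g * G_kernel d F x y"
    and Obs: "Obs \<in> local_algebra X"
    and R: "0 \<le> R" and t: "0 \<le> t"
  shows "op_norm (heisenberg (hamiltonian \<Phi>) Obs t
        - heisenberg (hamiltonian_on \<Phi> (fattening d X R)) Obs t)
    \<le> op_norm Obs * tail_sum d F \<Phi> X R * (exp (2 * g * t) - 1)"
proof -
  define \<phi> where "\<phi> Z = op_of (cscale \<i> (\<Phi> Z))" for Z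
  have sum: "(\<Sum>Z\<in>\<Z>. \<phi> Z) = op_of (cscale \<i> (\<Sum>Z\<in>\<Z>. \<Phi> Z))" for \<Z>
    by (simp add: \<phi>_def cscale_sum op_of_sum)
  have \<Phi>_comm: "A ** \<Phi> Y = \<Phi> Y ** A" if "A \<in> local_algebra Z" "Z \<inter> Y = {}" for A Y Z
    using that \<Phi> by (auto simp: fermionic_interaction_def intro: local_algebra_commute)
  have norm_\<phi>: "norm (\<phi> Z) = op_norm (\<Phi> Z)" for Z
    by (simp add: \<phi>_def norm_opalg.abs_eq op_norm_cscale_ii)
  interpret lieb_robinson \<phi> "G_kernel d F" g
  proof
    fix \<Z> :: "'a set set"
    have "self_adjoint (\<Sum>Z\<in>\<Z>. \<Phi> Z)"
      using \<Phi> by (simp add: fermionic_interaction_def self_adjoint_def dagger_sum)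
    then show "contractive (\<Sum>Z\<in>\<Z>. \<phi> Z)" unfolding sum by (rule contractive_self_adjoint)
  next
    fix Z Y :: "'a set" assume "Z \<inter> Y = {}"
    moreover have "\<Phi> Z \<in> local_algebra Z" using \<Phi> by (simp add: fermionic_interaction_def)
    ultimately have "\<Phi> Z ** \<Phi> Y = \<Phi> Y ** \<Phi> Z" by (intro \<Phi>_comm)
    then show "\<phi> Z * \<phi> Y = \<phi> Y * \<phi> Z"
      by (simp add: \<phi>_def times_opalg.abs_eq cscale_mult_left cscale_mult_right)
  next
    show "(\<Sum>Z | x \<in> Z \<and> y \<in> Z. norm (\<phi> Z)) \<le> g * G_kernel d F x y" for x y
      unfolding norm_\<phi> by (rule decay)
  qed (intro g G_kernel_nonneg G_kernel_convolution d F)+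
  have "\<phi> Z = 0 \<longleftrightarrow> \<Phi> Z = 0" for Z
    using norm_\<phi>[of Z] by (metis norm_eq_zero op_norm_eq_0)
  then have bd: "boundary X = Phi_boundary \<Phi> X"
    by (simp add: boundary_def Phi_boundary_def)
  have gen: "generator W = op_of (cscale \<i> (hamiltonian_on \<Phi> W))" for W
    by (simp add: generator_def sum hamiltonian_on_def)
  have "hamiltonian \<Phi> = hamiltonian_on \<Phi> UNIV"
    by (simp add: hamiltonian_def hamiltonian_on_def)
  have "op_of Obs * \<phi> Y = \<phi> Y * op_of Obs" if "Y \<inter> X = {}" for Y
    using \<Phi>_comm[OF Obs, of Y] that
    by (simp add: \<phi>_def times_opalg.abs_eq cscale_mult_left cscale_mult_right Int_commute)
  from truncation_error_le[OF subset_fattening[OF d R] this t, of X]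
    \<open>hamiltonian \<Phi> = hamiltonian_on \<Phi> UNIV\<close>
  show ?thesis
    by (simp add: op_norm_heisenberg_diff gen bd tail_def tail_sum_def norm_opalg.abs_eq
        Compl_eq_Diff_UNIV)
qed

theorem theorem7:
  fixes d :: "'a::{finite,linorder} \<Rightarrow> 'a \<Rightarrow> real"
    and F :: "real \<Rightarrow> real"
    and \<Phi> :: "'a set \<Rightarrow> 'a fock_op"
    and Obs :: "'a fock_op"
    and X\<^sub>0 :: "'a set"
    and \<psi>\<^sub>0 :: "'a fock"
    and g T R :: real
  assumes "Metric_space UNIV d"
    and "fermionic_interaction \<Phi>"
    and "F_function d F"
    and "g > 0"
    and "\<And>x y. (\<Sum>Z | x \<in> Z \<and> y \<in> Z. op_norm (\<Phi> Z)) \<le> g * G_kernel d F x y"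
    and "self_adjoint Obs" and "Obs \<in> local_algebra X\<^sub>0"
    and "T > 0" and "R > 0"
    and "norm \<psi>\<^sub>0 = 1"
  defines "H \<equiv> hamiltonian \<Phi>"
    and "H\<^sub>R \<equiv> hamiltonian_on \<Phi> (fattening d X\<^sub>0 R)"
  shows "cmod (dense_output H Obs \<psi>\<^sub>0 T - dense_output H\<^sub>R Obs \<psi>\<^sub>0 T)
           \<le> integral {0..T} (\<lambda>t. op_norm (heisenberg H Obs t - heisenberg H\<^sub>R Obs t)) \<and>
         integral {0..T} (\<lambda>t. op_norm (heisenberg H Obs t - heisenberg H\<^sub>R Obs t))
           \<le> 2 * op_norm Obs * tail_sum d F \<Phi> X\<^sub>0 R * integral {0..T} (\<lambda>t. exp (2 * g * t) - 1) \<and>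
         card (Phi_boundary \<Phi> X\<^sub>0) \<le> card X\<^sub>0 \<and>
         antimono_on {0<..} (tail_sum d F \<Phi> X\<^sub>0) \<and>
         (tail_sum d F \<Phi> X\<^sub>0 \<longlongrightarrow> 0) at_top"
proof (intro conjI)
  show "cmod (dense_output H Obs \<psi>\<^sub>0 T - dense_output H\<^sub>R Obs \<psi>\<^sub>0 T)
      \<le> integral {0..T} (\<lambda>t. op_norm (heisenberg H Obs t - heisenberg H\<^sub>R Obs t))"
    using assms(10) by (rule dense_output_diff_le)
  have "integral {0..T} (\<lambda>t. op_norm (heisenberg H Obs t - heisenberg H\<^sub>R Obs t))
      \<le> integral {0..T} (\<lambda>t. 2 * op_norm Obs * tail_sum d F \<Phi> X\<^sub>0 R * (exp (2 * g * t) - 1))"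
  proof (rule integral_le)
    fix t assume "t \<in> {0..T}"
    then have t: "0 \<le> t" by simp
    \<comment> \<open>The pointwise estimate is half of the stated one; nonnegativity allows the
      passage to the factor 2.\<close>
    have "0 \<le> op_norm Obs * tail_sum d F \<Phi> X\<^sub>0 R * (exp (2 * g * t) - 1)"
      using t assms(4) by (intro mult_nonneg_nonneg op_norm_nonneg tail_sum_nonneg assms(1,3)) simp
    moreover have "op_norm (heisenberg H Obs t - heisenberg H\<^sub>R Obs t)
        \<le> op_norm Obs * tail_sum d F \<Phi> X\<^sub>0 R * (exp (2 * g * t) - 1)"
      unfolding H_def H\<^sub>R_def
      using assms(9) by (intro heisenberg_truncation_le assms(1-5,7) t) simp
    ultimately show "op_norm (heisenberg H Obs t - heisenberg H\<^sub>R Obs t)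
        \<le> 2 * op_norm Obs * tail_sum d F \<Phi> X\<^sub>0 R * (exp (2 * g * t) - 1)" by simp
  qed (intro integrable_continuous_interval continuous_intros continuous_on_op_norm_heisenberg_diff)+
  then show "integral {0..T} (\<lambda>t. op_norm (heisenberg H Obs t - heisenberg H\<^sub>R Obs t))
      \<le> 2 * op_norm Obs * tail_sum d F \<Phi> X\<^sub>0 R * integral {0..T} (\<lambda>t. exp (2 * g * t) - 1)"
    by simp
  show "card (Phi_boundary \<Phi> X\<^sub>0) \<le> card X\<^sub>0"
    by (rule card_mono) (auto simp: Phi_boundary_def)
  show "antimono_on {0<..} (tail_sum d F \<Phi> X\<^sub>0)" by (rule antimono_tail_sum[OF assms(1,3)])
  show "(tail_sum d F \<Phi> X\<^sub>0 \<longlongrightarrow> 0) at_top" by (rule tail_sum_tendsto_0)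
qed

end
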